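(* The exponential map $\exp_e:T_e^*G\to G$ at the identity of a generalized H-type Carnot group $G$ of rank $k$ and dimension $n$ is given, in the exponential coordinates $(x,z)\in\mathbb R^k\times\mathbb R^{n-k}$ on $G$ and the dual coordinates $(u,v)\in\mathbb R^k\times\mathbb R^{n-k}$ on $T_e^*G$, by $\exp_e(u,v)=(x,z)$, where $$x=f(L_v)u,\qquad z=\left(\frac{g(L_v)u\cdot u}{2|v|}\right)\frac{v}{|v|},$$ $|\cdot|$ is the Euclidean norm and $f,g$ are the analytic functions $$f(z)=\frac{1-e^{-z}}{z},\qquad g(z)=1-\frac{\sinh(z)}{z}.$$ The geodesics $\gamma_\lambda:[0,1]\to G$ with initial covector $\lambda=(u,v)$ are given by $\gamma_\lambda(t)=\exp_e(tu,tv)$.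
   Context: **Generalized H-type Carnot groups.** A step 2 Carnot group of rank $k$ and dimension $n$ is a connected, simply connected Lie group $G$ of dimension $n$ whose Lie algebra splits as $\mathfrak g=\mathfrak g_1\oplus\mathfrak g_2$ with $\dim\mathfrak g_1=k$, $\dim\mathfrak g_2=n-k\ge 1$, $[\mathfrak g_1,\mathfrak g_1]=\mathfrak g_2$, $[\mathfrak g_1,\mathfrak g_2]=[\mathfrak g_2,\mathfrak g_2]=0$, with a fixed scalar product $\langle\!\langle\cdot,\cdot\rangle\!\rangle$ on $\mathfrak g$ such that $\mathfrak g_1\perp\mathfrak g_2$. For $V\in\mathfrak g_2$, $J_V:\mathfrak g_1\to\mathfrak g_1$ is the skew-symmetric operator with $\langle\!\langle X,J_VY\rangle\!\rangle=\langle\!\langle V,[X,Y]\rangle\!\rangle$ for all $X,Y\in\mathfrak g_1$. The group is of generalized H-type if there is a symmetric, non-zero, non-negative operator $S:\mathfrak g_1\to\mathfrak g_1$ with $J_VJ_W+J_WJ_V=-2\langle\!\langle V,W\rangle\!\rangle S^2$ for all $V,W\in\mathfrak g_2$. The sub-Riemannian structure is the left-invariant distribution generated by $\mathfrak g_1$ with the left-invariant metric induced by the scalar product on $\mathfrak g_1$. **Coordinates.** Fix orthonormal bases $e_1,\dots,e_k$ of $\mathfrak g_1$ (chosen so that $S$ is diagonal) and $f_1,\dots,f_{n-k}$ of $\mathfrak g_2$. A point $p\in G$ has coordinates $(x,z)$ iff $p=\mathrm{exp}_G(\sum_i x_ie_i+\sum_\alpha z_\alpha f_\alpha)$, with $\mathrm{exp}_G$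 the group exponential (a diffeomorphism); the identity is $e=(0,0)$. Let $L^\alpha$ be the skew-symmetric $k\times k$ matrices with $[e_i,e_j]=\sum_\alpha L^\alpha_{ij}f_\alpha$, and for $v\in\mathbb R^{n-k}$ put $L_v:=\sum_\alpha v_\alpha L^\alpha$; then $L_vL_w+L_wL_v=-2(v\cdot w)S^2$. A global orthonormal frame of the distribution is $$X_i=\partial_{x_i}-\tfrac12\sum_{\alpha}\sum_{j}L^\alpha_{ij}x_j\partial_{z_\alpha},\quad i=1,\dots,k.$$ A covector $\lambda\in T^*_eG$ is written $\lambda=\sum_i u_i\,dx_i+\sum_\alpha v_\alpha\,dz_\alpha$, i.e. $\lambda=(u,v)$. **Exponential map.** The Hamiltonian is $H(\lambda)=\frac12\sum_{i=1}^k\langle\lambda,X_i\rangle^2$ on $T^*G$, and $\vec H$ is its Hamiltonian vector field for the canonical symplectic form. $\exp_e(\lambda)=\pi(\lambda(1))$, where $\pi:T^*G\to G$ is the projection and $\lambda(t)$ is the integral curve of $\vec H$ with $\lambda(0)=\lambda$. The (normal) geodesic with initial covector $\lambda$ is $\gamma_\lambda(t)=\pi(\lambda(t))$. **Convention.** For an analytic function $F:\mathbb C\to\mathbb C$ and a square matrix $M$, $F(M)$ is the matrix obtained by evaluating on $M$ the Taylor series of $F$ at $0$. The functions $f,g$ are extended analytically at $z=0$ ($f(0)=1$, $g(0)=0$), and for $v=0$ the formula is understood in the limit, giving $\exp_e(u,0)=(u,0)$. *)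

theory Defs
  imports "HOL-Analysis.Analysis" "HOL-Algebra.Group"
begin

section \<open>Smooth maps and vector fields on Euclidean spaces\<close>

fun C_k :: "nat \<Rightarrow> ('a::euclidean_space \<Rightarrow> 'b::euclidean_space) \<Rightarrow> bool" where
  "C_k 0 F \<longleftrightarrow> continuous_on UNIV F"
| "C_k (Suc n) F \<longleftrightarrow>
     (\<forall>p. F differentiable (at p)) \<and> (\<forall>v. C_k n (\<lambda>p. frechet_derivative F (at p) v))"

definition smooth :: "('a::euclidean_space \<Rightarrow> 'b::euclidean_space) \<Rightarrow> bool" where
  "smooth F \<longleftrightarrow> (\<forall>n. C_k n F)"

definition vf_bracket :: "('a::real_normed_vector \<Rightarrow> 'a) \<Rightarrow> ('a \<Rightarrow> 'a) \<Rightarrow> 'a \<Rightarrow> 'a" where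
  "vf_bracket V W p = frechet_derivative W (at p) (V p) - frechet_derivative V (at p) (W p)"

definition integral_curve :: "('a::real_normed_vector \<Rightarrow> 'a) \<Rightarrow> (real \<Rightarrow> 'a) \<Rightarrow> bool" where
  "integral_curve V c \<longleftrightarrow> (\<forall>t. (c has_vector_derivative V (c t)) (at t))"


section \<open>Lie groups whose exponential map is a diffeomorphism\<close>

text \<open>
  \<^term>\<open>E\<close> is the group exponential, defined on the Lie algebra, whose underlying Euclidean space
  is the type of the arguments of \<^term>\<open>E\<close>. The manifold structure of the group is the one for
  which \<^term>\<open>E\<close> is a diffeomorphism, so smoothness of the group operations is expressed
  in the global chart \<^term>\<open>inv_into UNIV E\<close>. Every connected, simply connected nilpotent Lie group
  is of this form, and conversely such a group is diffeomorphic to a vector space, hence connected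
  and simply connected. The tangent space at the identity is identified with the Lie algebra by
  the differential of \<^term>\<open>E\<close> at 0.
\<close>

definition lie_group_exp :: "('p, 'q) monoid_scheme \<Rightarrow> ('g::euclidean_space \<Rightarrow> 'p) \<Rightarrow> bool" where
  "lie_group_exp G E \<longleftrightarrow>
     group G \<and> bij_betw E UNIV (carrier G) \<and>
     smooth (\<lambda>(X, Y). inv_into UNIV E (E X \<otimes>\<^bsub>G\<^esub> E Y)) \<and>
     smooth (\<lambda>X. inv_into UNIV E (inv\<^bsub>G\<^esub> (E X))) \<and>
     (\<forall>X s t. E ((s + t) *\<^sub>R X) = E (s *\<^sub>R X) \<otimes>\<^bsub>G\<^esub> E (t *\<^sub>R X))"

text \<open>The left-invariant vector field with value \<^term>\<open>X\<close> at the identity, read in the chart: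
  its value at \<^term>\<open>E p\<close> is the image of \<^term>\<open>X\<close> under the differential of the left translation.\<close>

definition left_field ::
  "('p, 'q) monoid_scheme \<Rightarrow> ('g::euclidean_space \<Rightarrow> 'p) \<Rightarrow> 'g \<Rightarrow> 'g \<Rightarrow> 'g" where
  "left_field G E X p =
     frechet_derivative (\<lambda>Y. inv_into UNIV E (E p \<otimes>\<^bsub>G\<^esub> E Y)) (at 0) X"

definition lie_bracket ::
  "('p, 'q) monoid_scheme \<Rightarrow> ('g::euclidean_space \<Rightarrow> 'p) \<Rightarrow> 'g \<Rightarrow> 'g \<Rightarrow> 'g" where
  "lie_bracket G E X Y = vf_bracket (left_field G E X) (left_field G E Y) 0"


section \<open>Generalized H-type Carnot groups\<close>

text \<open>The scalar product on the Lie algebra is the inner product of its type.\<close>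

definition step2_carnot_group ::
  "('p, 'q) monoid_scheme \<Rightarrow> ('g::euclidean_space \<Rightarrow> 'p) \<Rightarrow> 'g set \<Rightarrow> 'g set \<Rightarrow> nat \<Rightarrow> nat \<Rightarrow> bool"
where
  "step2_carnot_group G E g1 g2 k n \<longleftrightarrow>
     lie_group_exp G E \<and>
     DIM('g) = n \<and> subspace g1 \<and> subspace g2 \<and>
     (\<forall>X. \<exists>Y\<in>g1. \<exists>Z\<in>g2. X = Y + Z) \<and> (\<forall>Y\<in>g1. \<forall>Z\<in>g2. orthogonal Y Z) \<and>
     dim g1 = k \<and> dim g2 = n - k \<and> n - k \<ge> 1 \<and>
     span {lie_bracket G E X Y | X Y. X \<in> g1 \<and> Y \<in> g1} = g2 \<and>
     (\<forall>X\<in>g1. \<forall>Z\<in>g2. lie_bracket G E X Z = 0) \<and>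
     (\<forall>Y\<in>g2. \<forall>Z\<in>g2. lie_bracket G E Y Z = 0)"

definition J_op ::
  "('p, 'q) monoid_scheme \<Rightarrow> ('g::euclidean_space \<Rightarrow> 'p) \<Rightarrow> 'g set \<Rightarrow> 'g \<Rightarrow> 'g \<Rightarrow> 'g" where
  "J_op G E g1 V Y = (THE Z. Z \<in> g1 \<and> (\<forall>X\<in>g1. inner X Z = inner V (lie_bracket G E X Y)))"

text \<open>Only the restriction of \<^term>\<open>S\<close> to \<^term>\<open>g1\<close> is relevant; every linear operator on
  \<^term>\<open>g1\<close> is such a restriction.\<close>

definition H_type_operator ::
  "('p, 'q) monoid_scheme \<Rightarrow> ('g::euclidean_space \<Rightarrow> 'p) \<Rightarrow> 'g set \<Rightarrow> 'g set \<Rightarrow> ('g \<Rightarrow> 'g) \<Rightarrow> bool"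
where
  "H_type_operator G E g1 g2 S \<longleftrightarrow>
     linear S \<and> S ` g1 \<subseteq> g1 \<and>
     (\<forall>X\<in>g1. \<forall>Y\<in>g1. inner (S X) Y = inner X (S Y)) \<and>
     (\<exists>X\<in>g1. S X \<noteq> 0) \<and>
     (\<forall>X\<in>g1. 0 \<le> inner (S X) X) \<and>
     (\<forall>V\<in>g2. \<forall>W\<in>g2. \<forall>X\<in>g1.
        J_op G E g1 V (J_op G E g1 W X) + J_op G E g1 W (J_op G E g1 V X)
          = (- 2 * inner V W) *\<^sub>R S (S X))"


section \<open>Exponential coordinates\<close>

definition orthonormal_basis_of :: "'g::euclidean_space set \<Rightarrow> ('i::finite \<Rightarrow> 'g) \<Rightarrow> bool" where
  "orthonormal_basis_of U b \<longleftrightarrow>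
     (\<forall>i j. inner (b i) (b j) = (if i = j then 1 else 0)) \<and> span (range b) = U"

definition diagonalizes :: "('i \<Rightarrow> 'g::real_vector) \<Rightarrow> ('g \<Rightarrow> 'g) \<Rightarrow> bool" where
  "diagonalizes b S \<longleftrightarrow> (\<forall>i. \<exists>s. S (b i) = s *\<^sub>R b i)"

definition lincomb ::
  "('k::finite \<Rightarrow> 'g::euclidean_space) \<Rightarrow> ('m::finite \<Rightarrow> 'g) \<Rightarrow> (real^'k) \<times> (real^'m) \<Rightarrow> 'g" where
  "lincomb e f q = (\<Sum>i\<in>UNIV. fst q $ i *\<^sub>R e i) + (\<Sum>\<alpha>\<in>UNIV. snd q $ \<alpha> *\<^sub>R f \<alpha>)"

text \<open>The point of the group with exponential coordinates \<^term>\<open>q = (x, z)\<close>.\<close>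

definition exp_point ::
  "('g::euclidean_space \<Rightarrow> 'p) \<Rightarrow> ('k::finite \<Rightarrow> 'g) \<Rightarrow> ('m::finite \<Rightarrow> 'g)
     \<Rightarrow> (real^'k) \<times> (real^'m) \<Rightarrow> 'p" where
  "exp_point E e f q = E (lincomb e f q)"

text \<open>The matrices with entries the structure constants \<open>[e\<^sub>i, e\<^sub>j] = \<Sum>\<^sub>\<alpha> L\<^sup>\<alpha>\<^sub>i\<^sub>j f\<^sub>\<alpha>\<close>.\<close>

definition L_mat ::
  "('p, 'q) monoid_scheme \<Rightarrow> ('g::euclidean_space \<Rightarrow> 'p) \<Rightarrow> ('k::finite \<Rightarrow> 'g) \<Rightarrow> ('m::finite \<Rightarrow> 'g)
     \<Rightarrow> 'm \<Rightarrow> real^'k^'k" where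
  "L_mat G E e f \<alpha> = (\<chi> i j. inner (lie_bracket G E (e i) (e j)) (f \<alpha>))"

definition L_of ::
  "('p, 'q) monoid_scheme \<Rightarrow> ('g::euclidean_space \<Rightarrow> 'p) \<Rightarrow> ('k::finite \<Rightarrow> 'g) \<Rightarrow> ('m::finite \<Rightarrow> 'g)
     \<Rightarrow> real^'m \<Rightarrow> real^'k^'k" where
  "L_of G E e f v = (\<Sum>\<alpha>\<in>UNIV. v $ \<alpha> *\<^sub>R L_mat G E e f \<alpha>)"


section \<open>Hamiltonian flow and sub-Riemannian exponential map\<close>

text \<open>
  In the global coordinates \<^term>\<open>q\<close> of the group and the dual coordinates \<^term>\<open>p\<close>, the
  cotangent bundle is the set of pairs \<^term>\<open>(q, p)\<close>, the covector \<^term>\<open>p\<close> acts on tangent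
  vectors by the inner product, and the canonical symplectic form is \<open>dp \<and> dq\<close>.
\<close>

definition symp_form :: "'c::real_inner \<times> 'c \<Rightarrow> 'c \<times> 'c \<Rightarrow> real" where
  "symp_form v w = inner (snd v) (fst w) - inner (snd w) (fst v)"

definition hamiltonian_field ::
  "('c::real_inner \<times> 'c \<Rightarrow> real) \<Rightarrow> 'c \<times> 'c \<Rightarrow> 'c \<times> 'c" where
  "hamiltonian_field H l = (THE w. \<forall>v. symp_form v w = frechet_derivative H (at l) v)"

text \<open>The left-invariant field equal to \<open>e\<^sub>i\<close> at the identity, as a field of coordinate vectors.\<close>

definition frame_field ::
  "('p, 'q) monoid_scheme \<Rightarrow> ('g::euclidean_space \<Rightarrow> 'p) \<Rightarrow> ('k::finite \<Rightarrow> 'g) \<Rightarrow> ('m::finite \<Rightarrow> 'g)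
     \<Rightarrow> 'k \<Rightarrow> (real^'k) \<times> (real^'m) \<Rightarrow> (real^'k) \<times> (real^'m)" where
  "frame_field G E e f i q =
     ((\<chi> j. inner (left_field G E (e i) (lincomb e f q)) (e j)),
      (\<chi> \<alpha>. inner (left_field G E (e i) (lincomb e f q)) (f \<alpha>)))"

definition sr_hamiltonian ::
  "('p, 'q) monoid_scheme \<Rightarrow> ('g::euclidean_space \<Rightarrow> 'p) \<Rightarrow> ('k::finite \<Rightarrow> 'g) \<Rightarrow> ('m::finite \<Rightarrow> 'g)
     \<Rightarrow> ((real^'k) \<times> (real^'m)) \<times> ((real^'k) \<times> (real^'m)) \<Rightarrow> real" where
  "sr_hamiltonian G E e f l =
     1 / 2 * (\<Sum>i\<in>UNIV. (inner (snd l) (frame_field G E e f i (fst l)))\<^sup>2)"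

text \<open>
  The integral curve of the Hamiltonian field starting from the covector \<^term>\<open>\<mu>\<close> over the
  identity, which has coordinates 0. It is taken on the whole real line, since the field of a
  left-invariant sub-Riemannian structure is complete.
\<close>

definition extremal ::
  "('p, 'q) monoid_scheme \<Rightarrow> ('g::euclidean_space \<Rightarrow> 'p) \<Rightarrow> ('k::finite \<Rightarrow> 'g) \<Rightarrow> ('m::finite \<Rightarrow> 'g)
     \<Rightarrow> (real^'k) \<times> (real^'m) \<Rightarrow> real \<Rightarrow> ((real^'k) \<times> (real^'m)) \<times> ((real^'k) \<times> (real^'m))" where
  "extremal G E e f \<mu> =
     (THE c. integral_curve (hamiltonian_field (sr_hamiltonian G E e f)) c \<and> c 0 = (0, \<mu>))"

definition sr_geodesic ::
  "('p, 'q) monoid_scheme \<Rightarrow> ('g::euclidean_space \<Rightarrow> 'p) \<Rightarrow> ('k::finite \<Rightarrow> 'g) \<Rightarrow> ('m::finite \<Rightarrow> 'g)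
     \<Rightarrow> (real^'k) \<times> (real^'m) \<Rightarrow> real \<Rightarrow> 'p" where
  "sr_geodesic G E e f \<mu> t = exp_point E e f (fst (extremal G E e f \<mu> t))"

definition sr_exp ::
  "('p, 'q) monoid_scheme \<Rightarrow> ('g::euclidean_space \<Rightarrow> 'p) \<Rightarrow> ('k::finite \<Rightarrow> 'g) \<Rightarrow> ('m::finite \<Rightarrow> 'g)
     \<Rightarrow> (real^'k) \<times> (real^'m) \<Rightarrow> 'p" where
  "sr_exp G E e f \<mu> = exp_point E e f (fst (extremal G E e f \<mu> 1))"


section \<open>Analytic functions of matrices\<close>

text \<open>
  The series is summed entrywise. The scalars may be the complex or the real numbers;
  for a real matrix, only the restriction of the function to the real line is needed, because
  \<open>f_fun\<close> and \<open>g_fun\<close> have the same Taylor coefficients over both fields (lemmas below).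
  The usual power notation on the matrix type is the componentwise power, whence the iteration
  of the matrix product.
\<close>

definition fun_mat ::
  "('a::real_normed_field \<Rightarrow> 'a) \<Rightarrow> 'a^'n^'n \<Rightarrow> 'a^'n^'n" where
  "fun_mat F M =
     (\<chi> i j. \<Sum>r. (deriv ^^ r) F 0 / fact r * (((\<lambda>A. M ** A) ^^ r) (mat 1) $ i $ j))"

definition f_fun :: "'a::{banach, real_normed_field} \<Rightarrow> 'a" where
  "f_fun z = (if z = 0 then 1 else (1 - exp (- z)) / z)"

definition g_fun :: "'a::{banach, real_normed_field} \<Rightarrow> 'a" where
  "g_fun z = (if z = 0 then 0 else 1 - sinh z / z)"

lemma taylor_coeff_fps:
  fixes F :: "'a::{banach, real_normed_field} \<Rightarrow> 'a"
  assumes "F has_fps_expansion A"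
  shows "(deriv ^^ n) F 0 / fact n = fps_nth A n"
proof -
  have "(deriv ^^ n) F 0 = fact n * fps_nth A n"
    using assms
  proof (induction n arbitrary: F A)
    case 0
    then have "eval_fps A 0 = F 0"
      unfolding has_fps_expansion_def by (blast dest: eventually_nhds_x_imp_x)
    then show ?case
      by (simp add: eval_fps_at_0)
  next
    case (Suc n)
    from Suc.IH[OF has_fps_expansion_deriv[OF Suc.prems]] show ?case
      by (simp add: funpow_swap1 algebra_simps)
  qed
  then show ?thesis
    by simp
qed

lemma f_fun_taylor:
  "(deriv ^^ n) f_fun (0::'a::{banach, real_normed_field}) / fact n
     = of_real ((- 1) ^ n / fact (Suc n))"
proof -
  have "(\<lambda>x::'a. 1 - exp (- x)) has_fps_expansion 1 - fps_exp (- 1)"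
    by (intro fps_expansion_intros)
  moreover have "1 - fps_exp (- 1) \<noteq> (0::'a fps)"
    by (auto simp: fps_eq_iff intro!: exI[of _ 1])
  then have "1 \<le> subdegree (1 - fps_exp (- 1) :: 'a fps)"
    by (intro subdegree_geI) auto
  ultimately have "(\<lambda>x::'a. if x = 0 then 1 else (1 - exp (- x)) / x ^ 1)
          has_fps_expansion fps_shift 1 (1 - fps_exp (- 1))"
    by (rule has_fps_expansion_shift) simp
  moreover have "(\<lambda>x::'a. if x = 0 then 1 else (1 - exp (- x)) / x ^ 1) = f_fun"
    by (auto simp: f_fun_def fun_eq_iff)
  ultimately have "(f_fun :: 'a \<Rightarrow> 'a) has_fps_expansion fps_shift 1 (1 - fps_exp (- 1))"
    by simp
  from taylor_coeff_fps[OF this, of n] show ?thesis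
    by (simp add: algebra_simps)
qed

lemma g_fun_taylor:
  "(deriv ^^ n) g_fun (0::'a::{banach, real_normed_field}) / fact n
     = of_real (if even n \<and> n > 0 then - 1 / fact (Suc n) else 0)"
proof -
  let ?A = "fps_const (1 / 2) * (fps_exp 1 - fps_exp (- 1)) :: 'a fps"
  have sinh_eq: "(\<lambda>x::'a. 1 / 2 * (exp x - exp (- x))) = sinh"
    by (auto simp: sinh_def fun_eq_iff scaleR_conv_of_real)
  have "(\<lambda>x::'a. 1 / 2 * (exp x - exp (- x))) has_fps_expansion ?A"
    by (intro fps_expansion_intros)
  then have "(sinh :: 'a \<Rightarrow> 'a) has_fps_expansion ?A"
    by (simp only: sinh_eq)
  moreover have "fps_nth ?A 1 = 1"
    by simp
  then have "?A \<noteq> 0"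
    by (metis fps_zero_nth zero_neq_one)
  then have "1 \<le> subdegree ?A"
    by (rule subdegree_geI) simp
  ultimately have "(\<lambda>x::'a. if x = 0 then 1 else sinh x / x ^ 1) has_fps_expansion fps_shift 1 ?A"
    by (rule has_fps_expansion_shift) simp
  then have "(\<lambda>x::'a. 1 - (if x = 0 then 1 else sinh x / x ^ 1)) has_fps_expansion 1 - fps_shift 1 ?A"
    by (rule has_fps_expansion_diff[OF has_fps_expansion_1])
  moreover have "(\<lambda>x::'a. 1 - (if x = 0 then 1 else sinh x / x ^ 1)) = g_fun"
    by (auto simp: g_fun_def fun_eq_iff)
  ultimately have "(g_fun :: 'a \<Rightarrow> 'a) has_fps_expansion 1 - fps_shift 1 ?A"
    by simp
  from taylor_coeff_fps[OF this, of n]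
  have "(deriv ^^ n) g_fun (0::'a) / fact n = fps_nth (1 - fps_shift 1 ?A) n" .
  also have "\<dots> = of_real (if even n \<and> n > 0 then - 1 / fact (Suc n) else 0)"
  proof (cases "even n")
    case True
    have "fps_nth ?A (n + 1) = 1 / fact (Suc n)"
      using True by (simp del: fact_Suc)
    then show ?thesis
      using True by (simp del: fact_Suc)
  next
    case False
    have "fps_nth ?A (n + 1) = 0"
      using False by simp
    then show ?thesis
      using False by (cases "n = 0") simp_all
  qed
  finally show ?thesis .
qed

end

theory Submission
  imports Defs
begin

text \<open>
  In the chart given by the group exponential, brackets of left-invariant fields are left-invariant
  and the multiplication is additive on lines. Differentiating these two facts along a ray yields a
  linear differential equation, whose unique solution, when brackets of length three vanish, is
  that the left-invariant field of \<open>Y\<close> is \<open>p \<mapsto> Y + [p, Y] / 2\<close>.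

  Hence \<open>H = |h|\<^sup>2 / 2\<close> with \<open>h = p\<^sub>x - L\<^sub>v x / 2\<close>, and Hamilton's equations say that \<open>v\<close> is constant,
  \<open>x' = h = u - L\<^sub>v x\<close> and \<open>z' \<cdot> w = - h \<cdot> L\<^sub>w x / 2\<close>. The first equation is solved by
  \<open>x t = t f (t L\<^sub>v) u\<close>, and \<open>|x - y|\<close> is constant for two solutions \<open>x, y\<close>, as \<open>L\<^sub>v\<close> is skew.
  If \<open>w\<close> is orthogonal to \<open>v\<close>, then \<open>L\<^sub>w\<close> and \<open>L\<^sub>v\<close> anticommute, so \<open>L\<^sub>w L\<^sub>v\<^sup>n\<close> is skew for every \<open>n\<close>
  and \<open>h \<cdot> L\<^sub>w x = 0\<close>. So \<open>z\<close> is a multiple of \<open>v\<close>, and conservation of \<open>|h|\<close> gives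
  \<open>2 z \<cdot> v = t |u|\<^sup>2 - u \<cdot> x\<close>, whose value at \<open>t = 1\<close> is \<open>g (L\<^sub>v) u \<cdot> u\<close>.
\<close>

section \<open>Second derivatives and linear differential inequalities\<close>

lemma C_k_Suc_has_derivative:
  "C_k (Suc n) F \<Longrightarrow> (F has_derivative frechet_derivative F (at p)) (at p)"
  using frechet_derivative_works by auto

lemma C_k_Suc_frechet: "C_k (Suc n) F \<Longrightarrow> C_k n (\<lambda>p. frechet_derivative F (at p) v)"
  by simp

lemma has_vector_derivative_along_line:
  assumes "(F has_derivative F') (at (p + a *\<^sub>R v))"
  shows "((\<lambda>a. F (p + a *\<^sub>R v)) has_vector_derivative F' v) (at a)"
proof -
  have "((\<lambda>a. p + a *\<^sub>R v) has_vector_derivative v) (at a)"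
    by (auto intro!: derivative_eq_intros simp: has_vector_derivative_def)
  from vector_derivative_diff_chain_within[OF this has_derivative_at_withinI[OF assms]]
  show ?thesis by (simp add: o_def)
qed

text \<open>The mean value theorem is used twice: in direction \<open>v\<close> for the difference
  of two translates of \<open>F\<close>, then in direction \<open>w\<close> for the directional
  derivative along \<open>v\<close>. Pairing with \<open>b\<close> makes these functions scalar. The
  intermediate point \<open>q\<close> may vary with \<open>b\<close> and \<open>s\<close>; its
  distance from \<open>p\<close> is what matters in the limit.\<close>

lemma mixed_difference_mean_value:
  fixes F :: "'a::euclidean_space \<Rightarrow> 'b::euclidean_space"
  assumes F: "C_k (Suc (Suc 0)) F" and s: "s > 0"
  shows "\<exists>q. norm (q - p) \<le> s * (norm v + norm w) \<and>
    (F (p + s *\<^sub>R v + s *\<^sub>R w) - F (p + s *\<^sub>R v) - F (p + s *\<^sub>R w) + F p) \<bullet> b =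
     s\<^sup>2 * (frechet_derivative (\<lambda>q. frechet_derivative F (at q) v) (at q) w \<bullet> b)"
proof -
  let ?D = "\<lambda>q. frechet_derivative F (at q) v"
  have line: "((\<lambda>a. H (q + a *\<^sub>R x) \<bullet> b) has_real_derivative
      frechet_derivative H (at (q + a *\<^sub>R x)) x \<bullet> b) (at a)"
    if "C_k (Suc n) H" for H :: "'a \<Rightarrow> 'b" and q x n a
  proof -
    have "((\<lambda>a. H (q + a *\<^sub>R x)) has_vector_derivative
      frechet_derivative H (at (q + a *\<^sub>R x)) x) (at a)"
      by (rule has_vector_derivative_along_line[OF C_k_Suc_has_derivative[OF that]])
    from has_derivative_inner_left[OF this[unfolded has_vector_derivative_def], of b]
    show ?thesis
      by (simp add: has_field_derivative_def mult_commute_abs)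
  qed
  have "\<exists>a>0. a < s \<and> (F ((p + s *\<^sub>R w) + s *\<^sub>R v) \<bullet> b - F (p + s *\<^sub>R v) \<bullet> b) -
      (F ((p + s *\<^sub>R w) + 0 *\<^sub>R v) \<bullet> b - F (p + 0 *\<^sub>R v) \<bullet> b) =
      (s - 0) * (?D ((p + s *\<^sub>R w) + a *\<^sub>R v) \<bullet> b - ?D (p + a *\<^sub>R v) \<bullet> b)"
    by (rule MVT2[OF s]) (intro DERIV_diff line[OF F])
  then obtain a where a: "0 < a" "a < s" and
    "(F (p + s *\<^sub>R v + s *\<^sub>R w) - F (p + s *\<^sub>R v) - F (p + s *\<^sub>R w) + F p) \<bullet> b =
       s * (?D (p + a *\<^sub>R v + s *\<^sub>R w) \<bullet> b - ?D (p + a *\<^sub>R v) \<bullet> b)"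
    by (auto simp: algebra_simps)
  moreover have "\<exists>c>0. c < s \<and> ?D (p + a *\<^sub>R v + s *\<^sub>R w) \<bullet> b - ?D (p + a *\<^sub>R v + 0 *\<^sub>R w) \<bullet> b =
      (s - 0) * (frechet_derivative ?D (at (p + a *\<^sub>R v + c *\<^sub>R w)) w \<bullet> b)"
    by (rule MVT2[OF s]) (intro line[OF C_k_Suc_frechet[OF F]])
  then obtain c where c: "0 < c" "c < s" and
    "?D (p + a *\<^sub>R v + s *\<^sub>R w) \<bullet> b - ?D (p + a *\<^sub>R v) \<bullet> b =
      s * (frechet_derivative ?D (at (p + a *\<^sub>R v + c *\<^sub>R w)) w \<bullet> b)"
    by auto
  ultimately have eq:
    "(F (p + s *\<^sub>R v + s *\<^sub>R w) - F (p + s *\<^sub>R v) - F (p + s *\<^sub>R w) + F p) \<bullet> b =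
     s\<^sup>2 * (frechet_derivative ?D (at (p + a *\<^sub>R v + c *\<^sub>R w)) w \<bullet> b)"
    by (simp add: power2_eq_square)
  have "norm ((p + a *\<^sub>R v + c *\<^sub>R w) - p) \<le> norm (a *\<^sub>R v) + norm (c *\<^sub>R w)"
    by (metis add.assoc add_diff_cancel_left' norm_triangle_ineq)
  also have "\<dots> \<le> s * norm v + s * norm w"
    using a c by (intro add_mono) (auto intro!: mult_right_mono)
  finally show ?thesis
    using eq by (intro exI[of _ "p + a *\<^sub>R v + c *\<^sub>R w"]) (simp only: distrib_left)
qed

text \<open>The mixed difference is symmetric in \<open>v\<close> and \<open>w\<close>. Divided by
  the square of the step, it tends to the iterated derivative in either order, because the second
  derivatives are continuous and the intermediate points tend to \<open>p\<close>.\<close>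

lemma second_derivative_symmetric:
  fixes F :: "'a::euclidean_space \<Rightarrow> 'b::euclidean_space"
  assumes F: "C_k (Suc (Suc 0)) F"
  shows "frechet_derivative (\<lambda>q. frechet_derivative F (at q) v) (at p) w =
         frechet_derivative (\<lambda>q. frechet_derivative F (at q) w) (at p) v"
proof (rule euclidean_eqI)
  fix b :: 'b assume "b \<in> Basis"
  define D2 where "D2 v w q = frechet_derivative (\<lambda>q. frechet_derivative F (at q) v) (at q) w \<bullet> b" for v w q
  define \<Delta> where "\<Delta> v w s = (F (p + s *\<^sub>R v + s *\<^sub>R w) - F (p + s *\<^sub>R v) - F (p + s *\<^sub>R w) + F p) \<bullet> b"
    for v w s
  have cont: "isCont (D2 v w) q" for v w q
  proof -
    have "continuous_on UNIV (\<lambda>q. frechet_derivative (\<lambda>q. frechet_derivative F (at q) v) (at q) w)"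
      using F by simp
    then show ?thesis
      unfolding D2_def by (intro continuous_intros) (simp add: continuous_on_eq_continuous_at)
  qed
  have lim: "(\<lambda>n. \<Delta> v w (inverse (real (Suc n))) / (inverse (real (Suc n)))\<^sup>2) \<longlonglongrightarrow> D2 v w p" for v w
  proof -
    let ?s = "\<lambda>n. inverse (real (Suc n))"
    have "\<forall>n. \<exists>q. norm (q - p) \<le> ?s n * (norm v + norm w) \<and> \<Delta> v w (?s n) = (?s n)\<^sup>2 * D2 v w q"
      unfolding \<Delta>_def D2_def by (intro allI mixed_difference_mean_value[OF F]) simp
    then obtain q where q: "\<And>n. norm (q n - p) \<le> ?s n * (norm v + norm w)"
      "\<And>n. \<Delta> v w (?s n) = (?s n)\<^sup>2 * D2 v w (q n)"
      by metis
    have "(\<lambda>n. ?s n * (norm v + norm w)) \<longlonglongrightarrow> 0"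
      by (intro tendsto_mult_left_zero LIMSEQ_inverse_real_of_nat)
    then have "(\<lambda>n. q n - p) \<longlonglongrightarrow> 0"
      by (rule Lim_null_comparison[rotated]) (use q in simp)
    then have "q \<longlonglongrightarrow> p"
      by (simp add: LIM_zero_iff)
    then have "(\<lambda>n. D2 v w (q n)) \<longlonglongrightarrow> D2 v w p"
      by (rule isCont_tendsto_compose[OF cont])
    then show ?thesis
      using q(2) by simp
  qed
  have "\<Delta> w v = \<Delta> v w"
    by (simp add: \<Delta>_def fun_eq_iff algebra_simps)
  then have "D2 v w p = D2 w v p"
    using LIMSEQ_unique[OF lim[of v w]] lim[of w v] by simp
  then show "frechet_derivative (\<lambda>q. frechet_derivative F (at q) v) (at p) w \<bullet> b =
         frechet_derivative (\<lambda>q. frechet_derivative F (at q) w) (at p) v \<bullet> b"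
    by (simp add: D2_def)
qed

text \<open>\<open>C_k\<close> provides derivatives of the differential one fixed direction at a
  time. Expanding the varying direction \<open>V x\<close> in the basis reduces the claim to the
  product rule for finitely many terms.\<close>

lemma has_derivative_frechet_apply:
  fixes F :: "'a::euclidean_space \<Rightarrow> 'b::euclidean_space"
  assumes F: "C_k (Suc (Suc 0)) F"
    and P: "(P has_derivative P') (at x)" and V: "(V has_derivative V') (at x)"
  shows "((\<lambda>x. frechet_derivative F (at (P x)) (V x)) has_derivative
    (\<lambda>h. frechet_derivative (\<lambda>q. frechet_derivative F (at q) (V x)) (at (P x)) (P' h) +
          frechet_derivative F (at (P x)) (V' h))) (at x)"
proof -
  let ?D = "\<lambda>q. frechet_derivative F (at q)"
  have lin: "linear (?D q)" for q
    by (rule linear_frechet_derivative) (use F in simp)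
  have expand: "?D q y = (\<Sum>b\<in>Basis. (y \<bullet> b) *\<^sub>R ?D q b)" for q y
  proof -
    have "?D q y = ?D q (\<Sum>b\<in>Basis. (y \<bullet> b) *\<^sub>R b)"
      by (simp add: euclidean_representation)
    also have "\<dots> = (\<Sum>b\<in>Basis. (y \<bullet> b) *\<^sub>R ?D q b)"
      by (simp add: linear_sum[OF lin] linear_cmul[OF lin])
    finally show ?thesis .
  qed
  have D2: "((\<lambda>q. ?D q y) has_derivative frechet_derivative (\<lambda>q. ?D q y) (at q)) (at q)" for q y
    by (rule C_k_Suc_has_derivative[OF C_k_Suc_frechet[OF F]])
  have expand2: "frechet_derivative (\<lambda>q. ?D q y) (at q) h =
      (\<Sum>b\<in>Basis. (y \<bullet> b) *\<^sub>R frechet_derivative (\<lambda>q. ?D q b) (at q) h)" for q y h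
  proof -
    have "((\<lambda>q. \<Sum>b\<in>Basis. (y \<bullet> b) *\<^sub>R ?D q b) has_derivative
      (\<lambda>h. \<Sum>b\<in>Basis. (y \<bullet> b) *\<^sub>R frechet_derivative (\<lambda>q. ?D q b) (at q) h)) (at q)"
      by (intro derivative_intros D2)
    then have "((\<lambda>q. ?D q y) has_derivative
      (\<lambda>h. \<Sum>b\<in>Basis. (y \<bullet> b) *\<^sub>R frechet_derivative (\<lambda>q. ?D q b) (at q) h)) (at q)"
      by (simp add: expand[symmetric])
    then show ?thesis
      by (rule fun_cong[OF frechet_derivative_at, symmetric])
  qed
  have "((\<lambda>x. \<Sum>b\<in>Basis. (V x \<bullet> b) *\<^sub>R ?D (P x) b) has_derivative
     (\<lambda>h. \<Sum>b\<in>Basis. (V x \<bullet> b) *\<^sub>R frechet_derivative (\<lambda>q. ?D q b) (at (P x)) (P' h) +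
             (V' h \<bullet> b) *\<^sub>R ?D (P x) b)) (at x)"
    by (intro has_derivative_sum has_derivative_scaleR has_derivative_inner_left V
        has_derivative_compose[OF P D2])
  also have "(\<lambda>h. \<Sum>b\<in>Basis. (V x \<bullet> b) *\<^sub>R frechet_derivative (\<lambda>q. ?D q b) (at (P x)) (P' h) +
             (V' h \<bullet> b) *\<^sub>R ?D (P x) b) =
    (\<lambda>h. frechet_derivative (\<lambda>q. ?D q (V x)) (at (P x)) (P' h) + ?D (P x) (V' h))"
    by (simp add: expand2[of "V x"] expand[of _ "V' _"] sum.distrib)
  finally show ?thesis
    by (simp add: expand[symmetric])
qed

section \<open>Energy estimates for curves\<close>

lemma has_real_derivative_inner_self:
  fixes c :: "real \<Rightarrow> 'a::real_inner"
  assumes "(c has_vector_derivative c') (at t)"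
  shows "((\<lambda>t. c t \<bullet> c t) has_real_derivative 2 * (c t \<bullet> c')) (at t)"
  using assms
  by (auto simp: has_vector_derivative_def has_field_derivative_def inner_commute algebra_simps
      intro!: derivative_eq_intros)

text \<open>The function \<open>exp (- 2 K t) |w t|\<^sup>2\<close> is nonincreasing.\<close>

lemma linear_bound_vanishing:
  fixes w :: "real \<Rightarrow> 'a::real_inner"
  assumes w: "\<And>t. t \<in> {0..T} \<Longrightarrow> (w has_vector_derivative w' t) (at t)"
    and bound: "\<And>t. t \<in> {0..T} \<Longrightarrow> norm (w' t) \<le> K * norm (w t)"
    and "w 0 = 0" "0 \<le> T"
  shows "w T = 0"
proof -
  define \<phi> where "\<phi> t = exp (- 2 * K * t) * (w t \<bullet> w t)" for t
  have "\<phi> T \<le> \<phi> 0"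
  proof (rule DERIV_nonpos_imp_nonincreasing[OF \<open>0 \<le> T\<close>])
    fix t assume t: "0 \<le> t" "t \<le> T"
    have "((\<lambda>t. w t \<bullet> w t) has_real_derivative 2 * (w t \<bullet> w' t)) (at t)"
      using w[of t] t by (intro has_real_derivative_inner_self) auto
    then have "(\<phi> has_real_derivative
        exp (- 2 * K * t) * (2 * (w t \<bullet> w' t)) + (- 2 * K * exp (- 2 * K * t)) * (w t \<bullet> w t)) (at t)"
      unfolding \<phi>_def by (auto intro!: derivative_eq_intros)
    moreover have "w t \<bullet> w' t \<le> K * (w t \<bullet> w t)"
    proof -
      have "w t \<bullet> w' t \<le> norm (w t) * norm (w' t)"
        by (rule norm_cauchy_schwarz)
      also have "\<dots> \<le> norm (w t) * (K * norm (w t))"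
        using bound[of t] t by (auto intro!: mult_left_mono)
      finally show ?thesis
        by (simp add: dot_square_norm power2_eq_square algebra_simps)
    qed
    then have "exp (- 2 * K * t) * (2 * (w t \<bullet> w' t)) + (- 2 * K * exp (- 2 * K * t)) * (w t \<bullet> w t) \<le> 0"
      by (simp add: algebra_simps)
    ultimately show "\<exists>y. (\<phi> has_real_derivative y) (at t) \<and> y \<le> 0"
      by blast
  qed
  then have "exp (- 2 * K * T) * (w T \<bullet> w T) \<le> 0"
    using \<open>w 0 = 0\<close> by (simp add: \<phi>_def)
  then show ?thesis
    by (simp add: mult_le_0_iff dot_square_norm)
qed

section \<open>Left-invariant fields in exponential coordinates\<close>

text \<open>\<open>m\<close> is the group product read in the exponential chart. By
  \<open>one_param\<close> the lines through 0 are one-parameter subgroups, and 0 is the neutral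
  element.\<close>

locale exp_chart =
  fixes m :: "'g::euclidean_space \<times> 'g \<Rightarrow> 'g"
  assumes smooth: "smooth m"
    and assoc: "m (m (x, y), z) = m (x, m (y, z))"
    and one_param: "m (s *\<^sub>R x, t *\<^sub>R x) = (s + t) *\<^sub>R x"
begin

abbreviation D1 :: "'g \<times> 'g \<Rightarrow> 'g \<times> 'g \<Rightarrow> 'g" where
  "D1 P V \<equiv> frechet_derivative m (at P) V"

abbreviation D2 :: "'g \<times> 'g \<Rightarrow> 'g \<times> 'g \<Rightarrow> 'g \<times> 'g \<Rightarrow> 'g" where
  "D2 P V W \<equiv> frechet_derivative (\<lambda>P. frechet_derivative m (at P) V) (at P) W"

definition left :: "'g \<Rightarrow> 'g \<Rightarrow> 'g" where
  "left x p = D1 (p, 0) (0, x)"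

text \<open>\<open>left x\<close> differentiates \<open>m\<close> in the second slot, while its base
  point moves in the first slot; its derivative is therefore this mixed second derivative.\<close>

definition dleft :: "'g \<Rightarrow> 'g \<Rightarrow> 'g \<Rightarrow> 'g" where
  "dleft x p h = D2 (p, 0) (0, x) (h, 0)"

definition bracket :: "'g \<Rightarrow> 'g \<Rightarrow> 'g" where
  "bracket x y = vf_bracket (left x) (left y) 0"

lemma zero_left [simp]: "m (0, x) = x"
  using one_param[of 0 x 1] by simp

lemma zero_right [simp]: "m (x, 0) = x"
  using one_param[of 1 x 0] by simp

lemma C2: "C_k (Suc (Suc 0)) m"
  using smooth by (auto simp: smooth_def simp del: C_k.simps)

lemma m_has_derivative: "(m has_derivative D1 P) (at P)"
  by (rule C_k_Suc_has_derivative[OF C2])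

lemma D1_has_derivative: "((\<lambda>P. D1 P V) has_derivative D2 P V) (at P)"
  by (rule C_k_Suc_has_derivative[OF C_k_Suc_frechet[OF C2]])

lemma linear_D1: "linear (D1 P)"
  by (rule has_derivative_linear[OF m_has_derivative])

lemma linear_left: "linear (\<lambda>x. left x p)"
  by (rule linearI)
    (use linear_add[OF linear_D1, of "(p, 0)" "(0, _)" "(0, _)"]
      linear_cmul[OF linear_D1, of "(p, 0)" _ "(0, _)"] in \<open>auto simp: left_def\<close>)

lemma left_has_derivative: "(left x has_derivative dleft x p) (at p)"
  unfolding left_def dleft_def
  by (rule has_derivative_compose[OF _ D1_has_derivative])
    (auto intro!: derivative_eq_intros)

lemma frechet_left: "frechet_derivative (left x) (at p) = dleft x p"
  by (rule frechet_derivative_at[OF left_has_derivative, symmetric])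

lemma linear_dleft: "linear (dleft x p)"
  by (rule has_derivative_linear[OF left_has_derivative])

lemma linear_dleft_field: "linear (\<lambda>x. dleft x p h)"
proof (rule linearI)
  fix x y c
  have "(left (x + y) has_derivative (\<lambda>h. dleft x p h + dleft y p h)) (at p)"
    using has_derivative_add[OF left_has_derivative[of x p] left_has_derivative[of y p]]
    by (simp add: linear_add[OF linear_left, abs_def])
  from has_derivative_unique[OF left_has_derivative this]
  show "dleft (x + y) p h = dleft x p h + dleft y p h"
    by (simp add: fun_eq_iff)
  have "(left (c *\<^sub>R x) has_derivative (\<lambda>h. c *\<^sub>R dleft x p h)) (at p)"
    using has_derivative_scaleR_right[OF left_has_derivative[of x p], of c]
    by (simp add: linear_cmul[OF linear_left, abs_def])
  from has_derivative_unique[OF left_has_derivative this]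
  show "dleft (c *\<^sub>R x) p h = c *\<^sub>R dleft x p h"
    by (simp add: fun_eq_iff)
qed

section \<open>Left invariance of the fields and of their brackets\<close>

lemma translation_has_derivative: "((\<lambda>y. m (q, y)) has_derivative (\<lambda>y. D1 (q, p) (0, y))) (at p)"
  by (rule has_derivative_compose[OF _ m_has_derivative]) (auto intro!: derivative_eq_intros)

lemma left_eq: "left x p = frechet_derivative (\<lambda>y. m (p, y)) (at 0) x"
  using frechet_derivative_at[OF translation_has_derivative, of p 0] by (simp add: left_def fun_eq_iff)

lemma left_zero [simp]: "left x 0 = x"
  by (simp add: left_eq)

lemma bracket_eq: "bracket x y = dleft y 0 x - dleft x 0 y"
  by (simp add: bracket_def vf_bracket_def frechet_left)

text \<open>This is associativity, differentiated in the third argument at 0.\<close>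

lemma left_invariant: "D1 (q, p) (0, left x p) = left x (m (q, p))"
proof -
  have "((\<lambda>y. m (q, m (p, y))) has_derivative (\<lambda>y. D1 (q, m (p, 0)) (0, D1 (p, 0) (0, y)))) (at 0)"
    by (rule has_derivative_compose[OF translation_has_derivative translation_has_derivative])
  then have "((\<lambda>y. m (m (q, p), y)) has_derivative (\<lambda>y. D1 (q, p) (0, left y p))) (at 0)"
    by (simp add: assoc left_def)
  from frechet_derivative_at[OF this] show ?thesis
    by (simp add: left_eq fun_eq_iff)
qed

text \<open>Left invariance is differentiated in the base point at 0. The second-derivative term on
  the right is symmetric in \<open>x\<close> and \<open>y\<close>, so it cancels in the commutator
  of two fields.\<close>

lemma dleft_left: "dleft x q (left y q) = D2 (q, 0) (0, x) (0, y) + left (dleft x 0 y) q"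
proof -
  have "((\<lambda>p. D1 (q, p) (0, left x p)) has_derivative
      (\<lambda>h. D2 (q, 0) (0, left x 0) (0, h) + D1 (q, 0) (0, dleft x 0 h))) (at 0)"
    by (rule has_derivative_frechet_apply[OF C2])
      (auto intro!: derivative_eq_intros left_has_derivative)
  then have "((\<lambda>p. left x (m (q, p))) has_derivative
      (\<lambda>h. D2 (q, 0) (0, x) (0, h) + left (dleft x 0 h) q)) (at 0)"
    by (simp add: left_invariant left_def[symmetric])
  moreover have "((\<lambda>p. left x (m (q, p))) has_derivative (\<lambda>h. dleft x (m (q, 0)) (D1 (q, 0) (0, h)))) (at 0)"
    by (rule has_derivative_compose[OF translation_has_derivative left_has_derivative])
  ultimately have "(\<lambda>h. D2 (q, 0) (0, x) (0, h) + left (dleft x 0 h) q) =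
      (\<lambda>h. dleft x (m (q, 0)) (D1 (q, 0) (0, h)))"
    by (rule has_derivative_unique)
  then show ?thesis
    by (simp add: fun_eq_iff left_def[symmetric])
qed

lemma bracket_left_invariant: "dleft y q (left x q) - dleft x q (left y q) = left (bracket x y) q"
  by (simp add: dleft_left bracket_eq linear_diff[OF linear_left]
      second_derivative_symmetric[OF C2, of "(0, x)" _ "(0, y)"])

section \<open>Left-invariant fields along rays\<close>

lemma left_radial: "left p (t *\<^sub>R p) = p"
proof -
  have "((\<lambda>s. m (t *\<^sub>R p, 0 + s *\<^sub>R p)) has_vector_derivative D1 (t *\<^sub>R p, 0) (0, p)) (at 0)"
    by (rule has_vector_derivative_along_line) (use translation_has_derivative in simp)
  moreover have "((\<lambda>s. m (t *\<^sub>R p, 0 + s *\<^sub>R p)) has_vector_derivative p) (at 0)"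
    by (auto simp: one_param has_vector_derivative_def intro!: derivative_eq_intros)
  ultimately show ?thesis
    by (simp add: left_def vector_derivative_unique_at)
qed

text \<open>The product rule is applied to the radial identity \<open>left p p = p\<close>, and then
  \<open>p\<close> is specialised to \<open>t *\<^sub>R x\<close>. Keeping the factor
  \<open>t\<close> on the left avoids a division at the origin.\<close>

lemma dleft_radial: "t *\<^sub>R dleft x (t *\<^sub>R x) h = h - left h (t *\<^sub>R x)"
proof -
  have "((\<lambda>p. D1 (p, 0) (0, p)) has_derivative
      (\<lambda>h. D2 (p, 0) (0, p) (h, 0) + D1 (p, 0) (0, h))) (at p)" for p
    by (rule has_derivative_frechet_apply[OF C2]) (auto intro!: derivative_eq_intros)
  moreover have "D1 (p, 0) (0, p) = p" for p
    using left_radial[of p 1] by (simp add: left_def)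
  ultimately have "((\<lambda>p. p) has_derivative (\<lambda>h. dleft p p h + left h p)) (at p)" for p
    by (simp add: dleft_def left_def)
  then have "h = dleft p p h + left h p" for p
    by (rule fun_cong[OF has_derivative_unique[OF has_derivative_ident]])
  from this[of "t *\<^sub>R x"] show ?thesis
    by (simp add: linear_cmul[OF linear_dleft_field] algebra_simps)
qed

text \<open>This gives the uniform constant for \<open>linear_bound_vanishing\<close>: continuity on
  a compact interval bounds the image of each basis vector, and linearity does the rest.\<close>

lemma dleft_bound: "\<exists>K. \<forall>t\<in>{0..1}. \<forall>h. norm (dleft x (t *\<^sub>R x) h) \<le> K * norm h"
proof -
  have "\<exists>B. \<forall>t\<in>{0..1}. norm (dleft x (t *\<^sub>R x) b) \<le> B" for b
  proof -
    have "continuous_on UNIV (\<lambda>P. D2 P (0, x) (b, 0))"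
      using C2 by simp
    then have "continuous_on {0..1::real} (\<lambda>t. D2 (t *\<^sub>R x, 0) (0, x) (b, 0))"
      by (rule continuous_on_compose2) (auto intro!: continuous_intros)
    from compact_imp_bounded[OF compact_continuous_image[OF this]]
    show ?thesis
      by (auto simp: bounded_iff dleft_def)
  qed
  then obtain B where B: "\<And>b t. t \<in> {0..1} \<Longrightarrow> norm (dleft x (t *\<^sub>R x) b) \<le> B b"
    by metis
  have "norm (dleft x (t *\<^sub>R x) h) \<le> (\<Sum>b\<in>Basis. B b) * norm h" if "t \<in> {0..1}" for t h
  proof -
    let ?M = "dleft x (t *\<^sub>R x)"
    have "?M h = (\<Sum>b\<in>Basis. (h \<bullet> b) *\<^sub>R ?M b)"
      by (metis (no_types, lifting) euclidean_representation linear_sum[OF linear_dleft]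
          linear_cmul[OF linear_dleft] sum.cong)
    also have "norm \<dots> \<le> (\<Sum>b\<in>Basis. norm h * B b)"
      by (intro sum_norm_le) (auto intro!: mult_mono B that Basis_le_norm)
    finally show ?thesis
      by (simp only: sum_distrib_left mult.commute[of _ "norm h"])
  qed
  then show ?thesis by blast
qed

text \<open>The field \<open>w\<close> below measures the failure of the formula along the ray through \<open>x\<close>;
  it solves a homogeneous linear equation.\<close>

lemma left_eq_half_bracket:
  assumes nil: "bracket x (bracket x y) = 0"
  shows "left y x = y + (1 / 2) *\<^sub>R bracket x y"
proof -
  \<comment> \<open>Left invariance of the bracket trades the derivative of the field of
    \<open>z\<close> in direction \<open>x\<close> for \<open>dleft x\<close> applied to that field;
    by \<open>left_radial\<close>, the field of \<open>x\<close> equals \<open>x\<close> along the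
    ray.\<close>
  have ode: "((\<lambda>t. left z (t *\<^sub>R x)) has_vector_derivative
      dleft x (t *\<^sub>R x) (left z (t *\<^sub>R x)) + left (bracket x z) (t *\<^sub>R x)) (at t)" for z t
  proof -
    have "((\<lambda>t. left z (0 + t *\<^sub>R x)) has_vector_derivative dleft z (t *\<^sub>R x) x) (at t)"
      by (rule has_vector_derivative_along_line) (simp add: left_has_derivative)
    moreover have "dleft z (t *\<^sub>R x) x - dleft x (t *\<^sub>R x) (left z (t *\<^sub>R x)) =
        left (bracket x z) (t *\<^sub>R x)"
      using bracket_left_invariant[of z "t *\<^sub>R x" x] by (simp add: left_radial)
    ultimately show ?thesis
      by (simp add: algebra_simps)
  qed
  obtain K where K: "\<And>t h. t \<in> {0..1} \<Longrightarrow> norm (dleft x (t *\<^sub>R x) h) \<le> K * norm h"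
    using dleft_bound by blast
  have main: "left z x = z + (1 / 2) *\<^sub>R left c x"
    if c: "c = bracket x z" and xc: "bracket x c = 0" for z c
  proof -
    let ?M = "\<lambda>t. dleft x (t *\<^sub>R x)"
    \<comment> \<open>The factor \<open>t\<close> in front of the error makes
      \<open>dleft_radial\<close> applicable to the inhomogeneous term coming from
      \<open>z\<close>.\<close>
    define w where "w t = t *\<^sub>R left z (t *\<^sub>R x) - (t\<^sup>2 / 2) *\<^sub>R left c (t *\<^sub>R x) - t *\<^sub>R z" for t
    have "(w has_vector_derivative ?M t (w t)) (at t)" for t
    proof -
      have 1: "((\<lambda>t. left z (t *\<^sub>R x)) has_vector_derivative
          ?M t (left z (t *\<^sub>R x)) + left c (t *\<^sub>R x)) (at t)"
        using ode[of z t] by (simp add: c)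
      have 2: "((\<lambda>t. left c (t *\<^sub>R x)) has_vector_derivative ?M t (left c (t *\<^sub>R x))) (at t)"
        using ode[of c t] by (simp add: xc linear_0[OF linear_left])
      have "(w has_vector_derivative
          t *\<^sub>R (?M t (left z (t *\<^sub>R x)) + left c (t *\<^sub>R x)) + 1 *\<^sub>R left z (t *\<^sub>R x)
          - ((t\<^sup>2 / 2) *\<^sub>R ?M t (left c (t *\<^sub>R x)) + t *\<^sub>R left c (t *\<^sub>R x)) - 1 *\<^sub>R z) (at t)"
        unfolding w_def
        by (intro has_vector_derivative_diff has_vector_derivative_scaleR 1 2
            has_vector_derivative_scaleR[OF _ has_vector_derivative_const, THEN has_vector_derivative_eq_rhs])
          (auto intro!: derivative_eq_intros)
      moreover have "?M t (w t) = t *\<^sub>R ?M t (left z (t *\<^sub>R x)) -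
          (t\<^sup>2 / 2) *\<^sub>R ?M t (left c (t *\<^sub>R x)) - (z - left z (t *\<^sub>R x))"
        by (simp add: w_def linear_diff[OF linear_dleft] linear_cmul[OF linear_dleft] dleft_radial)
      ultimately show ?thesis
        by (elim has_vector_derivative_eq_rhs) (simp add: algebra_simps)
    qed
    then have "w 1 = 0"
      by (rule linear_bound_vanishing[where K = K]) (use K in \<open>auto simp: w_def\<close>)
    then show ?thesis
      by (simp add: w_def algebra_simps)
  qed
  \<comment> \<open>\<open>main\<close> is used twice. With \<open>bracket x y\<close> in place of
    \<open>z\<close>, the correction vanishes, so the field of \<open>bracket x y\<close> at
    \<open>x\<close> is \<open>bracket x y\<close> itself; this value enters the instance for
    \<open>y\<close>.\<close>
  have "bracket x 0 = 0"
    by (simp add: bracket_eq linear_0[OF linear_dleft] linear_0[OF linear_dleft_field])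
  then have "left (bracket x y) x = bracket x y"
    using main[of "bracket x (bracket x y)" "bracket x y"] by (simp add: nil linear_0[OF linear_left])
  with main[OF refl nil] show ?thesis
    by simp
qed

lemma linear_bracket_left: "linear (\<lambda>x. bracket x y)"
  unfolding bracket_eq by (intro linear_compose_sub linear_dleft linear_dleft_field)

lemma linear_bracket_right: "linear (\<lambda>y. bracket x y)"
  unfolding bracket_eq by (intro linear_compose_sub linear_dleft linear_dleft_field)

lemma bracket_antisym: "bracket y x = - bracket x y"
  by (simp add: bracket_eq)

end

section \<open>Power series of skew matrices\<close>

abbreviation matpow :: "'a::semiring_1^'n^'n \<Rightarrow> nat \<Rightarrow> 'a^'n^'n" where
  "matpow M r \<equiv> ((\<lambda>A. M ** A) ^^ r) (mat 1)"

text \<open>The sum of the absolute values of all entries serves as a crude submultiplicative norm,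
  enough for an exponential majorant.\<close>

lemma matpow_entry_bound:
  fixes M :: "real^'n^'n"
  shows "\<bar>matpow M r $ i $ j\<bar> \<le> (\<Sum>i\<in>UNIV. \<Sum>j\<in>UNIV. \<bar>M $ i $ j\<bar>) ^ r"
proof (induction r arbitrary: i)
  case 0
  then show ?case by (simp add: mat_def)
next
  case (Suc r)
  let ?B = "\<Sum>i\<in>UNIV. \<Sum>j\<in>UNIV. \<bar>M $ i $ j\<bar>"
  have B: "0 \<le> ?B"
    by (intro sum_nonneg) simp
  have "\<bar>matpow M (Suc r) $ i $ j\<bar> = \<bar>\<Sum>l\<in>UNIV. M $ i $ l * matpow M r $ l $ j\<bar>"
    by (simp add: matrix_matrix_mult_def)
  also have "\<dots> \<le> (\<Sum>l\<in>UNIV. \<bar>M $ i $ l\<bar> * ?B ^ r)"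
    by (rule order_trans[OF sum_abs]) (auto simp: abs_mult intro!: sum_mono mult_left_mono Suc)
  also have "\<dots> = (\<Sum>l\<in>UNIV. \<bar>M $ i $ l\<bar>) * ?B ^ r"
    by (simp add: sum_distrib_right)
  also have "\<dots> \<le> ?B * ?B ^ r"
    by (intro mult_right_mono zero_le_power B member_le_sum) (auto intro!: sum_nonneg)
  finally show ?case by simp
qed

lemma matpow_mult_vec:
  fixes M :: "'a::comm_semiring_1^'n^'n"
  shows "matpow M r *v u = (((*v) M) ^^ r) u"
  by (induction r) (auto simp flip: matrix_vector_mul_assoc)

text \<open>The factorial bound holds for the Taylor coefficients of both \<open>f_fun\<close> and
  \<open>g_fun\<close>, and dominates each entry by an exponential series. Entrywise convergence
  then gives convergence of the vectors.\<close>

lemma fun_mat_sums: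
  fixes M :: "real^'n^'n"
  assumes a: "\<And>r. (deriv ^^ r) F 0 / fact r = a r" and bound: "\<And>r. \<bar>a r\<bar> \<le> 1 / fact r"
  shows "(\<lambda>r. a r *\<^sub>R (((*v) M) ^^ r) u) sums (fun_mat F M *v u)"
proof -
  let ?B = "\<Sum>i\<in>UNIV. \<Sum>j\<in>UNIV. \<bar>M $ i $ j\<bar>"
  have entry: "(\<lambda>r. a r * matpow M r $ i $ j) sums (fun_mat F M $ i $ j)" for i j
  proof -
    have "summable (\<lambda>r. a r * matpow M r $ i $ j)"
    proof (rule summable_comparison_test')
      show "summable (\<lambda>r. inverse (fact r) * ?B ^ r)"
        by (rule summable_exp)
      show "norm (a r * matpow M r $ i $ j) \<le> inverse (fact r) * ?B ^ r" for r
        unfolding real_norm_def abs_mult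
        by (intro mult_mono matpow_entry_bound) (use bound[of r] in \<open>auto simp: inverse_eq_divide\<close>)
    qed
    then show ?thesis
      by (simp add: fun_mat_def a summable_sums)
  qed
  have "(\<lambda>r. (a r *\<^sub>R (matpow M r *v u)) $ i) sums ((fun_mat F M *v u) $ i)" for i
  proof -
    have "(\<lambda>r. \<Sum>j\<in>UNIV. a r * matpow M r $ i $ j * u $ j) sums (\<Sum>j\<in>UNIV. fun_mat F M $ i $ j * u $ j)"
      by (intro sums_sum sums_mult2 entry)
    then show ?thesis
      by (simp add: matrix_vector_mult_def sum_distrib_left mult.assoc)
  qed
  then have "(\<lambda>r. a r *\<^sub>R (matpow M r *v u)) sums (fun_mat F M *v u)"
    unfolding sums_def by (intro vec_tendstoI) simp
  then show ?thesis
    by (simp add: matpow_mult_vec)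
qed

text \<open>This is the integral of \<open>exp (- s M) u\<close> over \<open>s\<close> from 0 to
  \<open>t\<close>. Scaling both \<open>M\<close> and \<open>u\<close> by \<open>t\<close> builds in
  the homogeneity of geodesics.\<close>

definition horizontal_curve :: "real^'n^'n \<Rightarrow> real^'n \<Rightarrow> real \<Rightarrow> real^'n" where
  "horizontal_curve M u t = fun_mat f_fun (t *\<^sub>R M) *v (t *\<^sub>R u)"

lemma funpow_scaled_mult_vec:
  fixes M :: "real^'n^'n"
  shows "(((*v) (t *\<^sub>R M)) ^^ r) (s *\<^sub>R u) = (s * t ^ r) *\<^sub>R (((*v) M) ^^ r) u"
  by (induction r) (auto simp: matrix_vector_mult_scaleR scaleR_matrix_vector_assoc[symmetric] mult_ac)

lemma horizontal_curve_sums: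
  "(\<lambda>r. ((- 1) ^ r / fact (Suc r) * t ^ Suc r) *\<^sub>R (((*v) M) ^^ r) u) sums horizontal_curve M u t"
proof -
  have "(\<lambda>r. ((- 1) ^ r / fact (Suc r)) *\<^sub>R (((*v) (t *\<^sub>R M)) ^^ r) (t *\<^sub>R u)) sums horizontal_curve M u t"
    unfolding horizontal_curve_def
  proof (rule fun_mat_sums)
    show "(deriv ^^ r) f_fun (0::real) / fact r = (- 1) ^ r / fact (Suc r)" for r
      by (simp add: f_fun_taylor del: fact_Suc)
    show "\<bar>(- 1) ^ r / fact (Suc r)\<bar> \<le> (1 / fact r :: real)" for r
      by (simp add: abs_divide power_abs divide_simps fact_mono del: fact_Suc)
  qed
  then show ?thesis
    by (simp add: funpow_scaled_mult_vec mult.assoc del: fact_Suc)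
qed

lemma horizontal_curve_0 [simp]: "horizontal_curve M u 0 = 0"
  by (simp add: horizontal_curve_def)

text \<open>After pairing with a fixed vector \<open>b\<close>, the curve is an everywhere
  convergent real power series, which is differentiated term by term.\<close>

lemma horizontal_curve_has_vector_derivative:
  "(horizontal_curve M u has_vector_derivative u - M *v horizontal_curve M u t) (at t)"
proof -
  let ?T = "\<lambda>r. (((*v) M) ^^ r) u"
  have "((\<lambda>t. horizontal_curve M u t \<bullet> b) has_real_derivative (u - M *v horizontal_curve M u t) \<bullet> b) (at t)" for b
  proof -
    \<comment> \<open>The series starts at exponent 1, so the coefficients are shifted and the
      constant one is 0.\<close>
    define c where "c n = (case n of 0 \<Rightarrow> 0 | Suc r \<Rightarrow> (- 1) ^ r / fact (Suc r) * (?T r \<bullet> b))" for n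
    have c_Suc: "c (Suc r) = (- 1) ^ r / fact (Suc r) * (?T r \<bullet> b)" for r
      by (simp add: c_def)
    have sums: "(\<lambda>n. c n * t ^ n) sums (horizontal_curve M u t \<bullet> b)" for t
    proof -
      have "(\<lambda>r. c (Suc r) * t ^ Suc r) sums (horizontal_curve M u t \<bullet> b)"
        using bounded_linear.sums[OF bounded_linear_inner_left horizontal_curve_sums[of t M u], of b]
        by (simp add: c_Suc mult_ac del: fact_Suc)
      then show ?thesis
        using sums_Suc[of "\<lambda>n. c n * t ^ n" "horizontal_curve M u t \<bullet> b"] by (simp add: c_def del: fact_Suc)
    qed
    have diffs: "diffs c n = (- 1) ^ n / fact n * (?T n \<bullet> b)" for n
      by (simp add: diffs_def c_Suc divide_simps)
    \<comment> \<open>Applying \<open>- M\<close> to the series of the curve produces the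
      differentiated series from exponent 1 on; the missing constant term is
      \<open>u \<bullet> b\<close>.\<close>
    have "(\<lambda>r. diffs c (Suc r) * t ^ Suc r) sums (- (M *v horizontal_curve M u t) \<bullet> b)"
    proof -
      have "bounded_linear (\<lambda>x. - (M *v x) \<bullet> b)"
        by (rule bounded_linear_compose[OF bounded_linear_inner_left
            bounded_linear_minus[OF matrix_vector_mul_bounded_linear]])
      from bounded_linear.sums[OF this horizontal_curve_sums[of t M u]] show ?thesis
        by (simp add: diffs matrix_vector_mult_scaleR mult_ac del: fact_Suc)
    qed
    then have "(\<lambda>n. diffs c n * t ^ n) sums (- (M *v horizontal_curve M u t) \<bullet> b + u \<bullet> b)"
      using sums_Suc[of "\<lambda>n. diffs c n * t ^ n" "- (M *v horizontal_curve M u t) \<bullet> b"] by (simp add: diffs)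
    moreover have "((\<lambda>t. \<Sum>n. c n * t ^ n) has_real_derivative (\<Sum>n. diffs c n * t ^ n)) (at t)"
      by (rule termdiffs_strong_converges_everywhere) (rule sums_summable[OF sums])
    moreover have "(\<lambda>t. \<Sum>n. c n * t ^ n) = (\<lambda>t. horizontal_curve M u t \<bullet> b)"
      using sums_unique[OF sums] by (simp add: fun_eq_iff)
    ultimately show ?thesis
      by (simp add: sums_iff inner_diff_left)
  qed
  then show ?thesis
    unfolding has_vector_derivative_def has_field_derivative_def
    by (subst has_derivative_componentwise_within) (simp add: mult_commute_abs)
qed

section \<open>Skew matrices and quadratic forms of their powers\<close>

locale skew_matrix =
  fixes M :: "real^'n^'n"
  assumes skew: "(M *v x) \<bullet> y = - (x \<bullet> (M *v y))"
begin

lemma inner_mult_self [simp]: "x \<bullet> (M *v x) = 0"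
  using skew[of x x] by (simp add: inner_commute)

lemma skew_funpow: "((((*v) M) ^^ r) x) \<bullet> y = (- 1) ^ r * (x \<bullet> ((((*v) M) ^^ r) y))"
  by (induction r arbitrary: y) (auto simp: skew funpow_swap1[symmetric])

lemma odd_funpow_inner: "odd r \<Longrightarrow> ((((*v) M) ^^ r) x) \<bullet> x = 0"
  using skew_funpow[of r x x] by (simp add: inner_commute)

text \<open>The even parts of the series of \<open>f\<close> and \<open>1 - g\<close> coincide, and odd powers do not contribute.\<close>

lemma g_fun_inner: "(fun_mat g_fun M *v u) \<bullet> u = u \<bullet> u - u \<bullet> horizontal_curve M u 1"
proof -
  let ?T = "\<lambda>r. (((*v) M) ^^ r) u"
  let ?g = "\<lambda>r. (if even r \<and> r > 0 then - 1 / fact (Suc r) else 0) :: real"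
  have "(\<lambda>r. ?g r *\<^sub>R ?T r) sums (fun_mat g_fun M *v u)"
  proof (rule fun_mat_sums)
    show "(deriv ^^ r) g_fun (0::real) / fact r = ?g r" for r
      by (simp add: g_fun_taylor del: fact_Suc)
    show "\<bar>?g r\<bar> \<le> (1 / fact r :: real)" for r
      by (simp add: abs_divide power_abs divide_simps fact_mono del: fact_Suc)
  qed
  from sums_add[OF this horizontal_curve_sums[of 1 M u]]
  have "(\<lambda>r. (?g r + (- 1) ^ r / fact (Suc r)) *\<^sub>R ?T r) sums (fun_mat g_fun M *v u + horizontal_curve M u 1)"
    by (simp add: scaleR_left_distrib del: fact_Suc)
  from bounded_linear.sums[OF bounded_linear_inner_left this, of u]
  have "(\<lambda>r. (?g r + (- 1) ^ r / fact (Suc r)) * (?T r \<bullet> u)) sums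
      ((fun_mat g_fun M *v u + horizontal_curve M u 1) \<bullet> u)"
    by (simp del: fact_Suc)
  also have "(\<lambda>r. (?g r + (- 1) ^ r / fact (Suc r)) * (?T r \<bullet> u)) =
      (\<lambda>r. if r = 0 then u \<bullet> u else 0)"
    by (auto simp: fun_eq_iff odd_funpow_inner simp del: fact_Suc)
  finally have "(fun_mat g_fun M *v u + horizontal_curve M u 1) \<bullet> u = u \<bullet> u"
    using sums_unique2 sums_single[of 0 "\<lambda>_. u \<bullet> u"] by blast
  then show ?thesis
    by (simp add: inner_add_right inner_commute)
qed

end

text \<open>Transposing \<open>N\<close> times the \<open>r\<close>-th power of \<open>M\<close>
  reverses the product with sign \<open>(- 1) ^ (r + 1)\<close>, and anticommutation restores the
  order with sign \<open>(- 1) ^ r\<close>. So each term of the series equals its own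
  negative.\<close>

lemma anticommuting_inner_horizontal_curve:
  assumes "skew_matrix M" "skew_matrix N"
    and anti: "\<And>y. N *v (M *v y) = - (M *v (N *v y))"
  shows "u \<bullet> (N *v horizontal_curve M u t) = 0"
proof -
  interpret M: skew_matrix M by fact
  interpret N: skew_matrix N by fact
  let ?T = "\<lambda>r. (((*v) M) ^^ r) u"
  have comm: "(((*v) M) ^^ r) (N *v y) = (- 1) ^ r *\<^sub>R (N *v (((*v) M) ^^ r) y)" for r y
    by (induction r) (auto simp: matrix_vector_mult_scaleR anti)
  have "u \<bullet> (N *v ?T r) = 0" for r
  proof -
    have "u \<bullet> (N *v ?T r) = - (?T r \<bullet> (N *v u))"
      by (metis N.skew inner_commute)
    also have "\<dots> = - (u \<bullet> (N *v ?T r))"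
      by (simp add: M.skew_funpow comm flip: power_add)
    finally show ?thesis by simp
  qed
  then have "(\<lambda>r. u \<bullet> (N *v (((- 1) ^ r / fact (Suc r) * t ^ Suc r) *\<^sub>R ?T r))) = (\<lambda>_. 0)"
    by (simp add: fun_eq_iff matrix_vector_mult_scaleR)
  moreover have "(\<lambda>r. u \<bullet> (N *v (((- 1) ^ r / fact (Suc r) * t ^ Suc r) *\<^sub>R ?T r)))
      sums (u \<bullet> (N *v horizontal_curve M u t))"
    by (rule bounded_linear.sums[OF bounded_linear_compose[OF bounded_linear_inner_right
        matrix_vector_mul_bounded_linear] horizontal_curve_sums])
  ultimately show ?thesis
    using sums_unique2[OF sums_zero] by metis
qed

section \<open>The Hamiltonian system\<close>

lemma hamiltonian_field_eqI:
  assumes "(H has_derivative (\<lambda>v. symp_form v w)) (at l)"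
  shows "hamiltonian_field H l = w"
  unfolding hamiltonian_field_def frechet_derivative_at[OF assms, symmetric]
proof (rule the_equality)
  fix w' assume eq: "\<forall>v. symp_form v w' = symp_form v w"
  define d where "d = w' - w"
  have "symp_form v d = symp_form v w' - symp_form v w" for v
    by (simp add: d_def symp_form_def inner_diff_left inner_diff_right)
  \<comment> \<open>The test vector is \<open>d\<close> rotated by the standard complex structure;
    it turns the symplectic form into the squared norm of \<open>d\<close>.\<close>
  with eq have "symp_form (- snd d, fst d) d = 0"
    by simp
  then have "fst d \<bullet> fst d + snd d \<bullet> snd d = 0"
    by (simp add: symp_form_def)
  then have "d = 0"
    by (simp add: add_nonneg_eq_0_iff prod_eq_iff)
  then show "w' = w"
    by (simp add: d_def)
qed simp

lemma has_vector_derivative_zero_imp_const: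
  fixes f :: "real \<Rightarrow> 'a::real_normed_vector"
  assumes "\<And>t. (f has_vector_derivative 0) (at t)"
  shows "f t = f 0"
  using has_vector_derivative_zero_constant[of UNIV f] assms by (metis UNIV_I convex_UNIV)

lemma has_vector_derivative_fst:
  "(c has_vector_derivative c') F \<Longrightarrow> ((\<lambda>t. fst (c t)) has_vector_derivative fst c') F"
  by (rule bounded_linear.has_vector_derivative[OF bounded_linear_fst])

lemma has_vector_derivative_snd:
  "(c has_vector_derivative c') F \<Longrightarrow> ((\<lambda>t. snd (c t)) has_vector_derivative snd c') F"
  by (rule bounded_linear.has_vector_derivative[OF bounded_linear_snd])

lemma has_vector_derivative_matrix_mult:
  fixes M :: "real^'n^'m"
  shows "(c has_vector_derivative c') F \<Longrightarrow> ((\<lambda>t. M *v c t) has_vector_derivative M *v c') F"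
  by (rule bounded_linear.has_vector_derivative[OF matrix_vector_mul_bounded_linear])

lemma half_plus_half: "u - (1 / 2) *\<^sub>R x - (1 / 2) *\<^sub>R x = u - (x :: 'a::real_vector)"
proof -
  have "u - (1 / 2) *\<^sub>R x - (1 / 2) *\<^sub>R x = u - (1 / 2 + 1 / 2) *\<^sub>R x"
    by (simp only: scaleR_left_distrib) simp
  then show ?thesis by simp
qed

text \<open>The H-type relation enters through orthogonal pairs, for which its right-hand side
  \<open>- 2 (v \<bullet> w) S\<^sup>2\<close> vanishes.\<close>

locale h_type_matrices =
  fixes L :: "'m::finite \<Rightarrow> real^'k::finite^'k"
  assumes skew_L: "L \<alpha> $ i $ j = - L \<alpha> $ j $ i"
    and anticommute: "v \<bullet> w = 0 \<Longrightarrow>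
      (\<Sum>\<alpha>\<in>UNIV. v $ \<alpha> *\<^sub>R L \<alpha>) *v ((\<Sum>\<alpha>\<in>UNIV. w $ \<alpha> *\<^sub>R L \<alpha>) *v y) =
        - ((\<Sum>\<alpha>\<in>UNIV. w $ \<alpha> *\<^sub>R L \<alpha>) *v ((\<Sum>\<alpha>\<in>UNIV. v $ \<alpha> *\<^sub>R L \<alpha>) *v y))"
begin

definition A :: "real^'m \<Rightarrow> real^'k^'k" where
  "A v = (\<Sum>\<alpha>\<in>UNIV. v $ \<alpha> *\<^sub>R L \<alpha>)"

lemma skew_A: "skew_matrix (A v)"
proof
  have sk: "A v $ i $ j = - A v $ j $ i" for i j
    by (simp add: A_def skew_L[of _ i j] sum_negf)
  show "(A v *v x) \<bullet> y = - (x \<bullet> (A v *v y))" for x y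
  proof -
    have "(A v *v x) \<bullet> y = (\<Sum>i\<in>UNIV. \<Sum>j\<in>UNIV. A v $ i $ j * x $ j * y $ i)"
      by (simp add: inner_vec_def matrix_vector_mult_def sum_distrib_right)
    also have "\<dots> = (\<Sum>j\<in>UNIV. \<Sum>i\<in>UNIV. A v $ i $ j * x $ j * y $ i)"
      by (rule sum.swap)
    also have "\<dots> = (\<Sum>j\<in>UNIV. \<Sum>i\<in>UNIV. - (x $ j * (A v $ j $ i * y $ i)))"
      by (intro sum.cong refl) (subst sk, simp)
    also have "\<dots> = - (x \<bullet> (A v *v y))"
      by (simp add: inner_vec_def matrix_vector_mult_def sum_distrib_left sum_negf)
    finally show ?thesis .
  qed
qed

lemma A_add: "A (v + w) = A v + A w"
  by (simp add: A_def scaleR_left_distrib sum.distrib)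

lemma A_scaleR: "A (c *\<^sub>R v) = c *\<^sub>R A v"
  by (simp add: A_def scaleR_sum_right)

lemma anticommute_A: "v \<bullet> w = 0 \<Longrightarrow> A v *v (A w *v y) = - (A w *v (A v *v y))"
  unfolding A_def by (rule anticommute)

text \<open>The vector representing the linear form
  \<open>w \<mapsto> h \<bullet> (A w *v x)\<close>, see \<open>inner_J\<close>; it gives the
  vertical velocity.\<close>

definition J :: "real^'k \<Rightarrow> real^'k \<Rightarrow> real^'m" where
  "J h x = (\<chi> \<alpha>. h \<bullet> (L \<alpha> *v x))"

lemma A_mult_vec: "A w *v x = (\<Sum>\<alpha>\<in>UNIV. w $ \<alpha> *\<^sub>R (L \<alpha> *v x))"
  unfolding A_def
  by (simp add: vec_eq_iff matrix_vector_mult_def sum_distrib_left sum_distrib_right mult.assoc)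
    (simp add: sum.swap[of _ "UNIV :: 'k set"])

lemma inner_J: "w \<bullet> J h x = h \<bullet> (A w *v x)"
  by (simp add: A_mult_vec J_def inner_vec_def[of w] inner_sum_right)

text \<open>The components of \<open>h\<close> are the values of the covector on the frame fields;
  \<open>sr_hamiltonian_eq\<close> makes this precise.\<close>

definition ham :: "((real^'k) \<times> (real^'m)) \<times> ((real^'k) \<times> (real^'m)) \<Rightarrow> real" where
  "ham l = (let h = fst (snd l) - (1 / 2) *\<^sub>R (A (snd (snd l)) *v fst (fst l)) in 1 / 2 * (h \<bullet> h))"

lemma bounded_bilinear_A: "bounded_bilinear (\<lambda>v x. A v *v x)"
  by (simp add: bilinear_conv_bounded_bilinear[symmetric] bilinear_def linear_iff A_add A_scaleR
      matrix_vector_mult_add_rdistrib scaleR_matrix_vector_assoc[symmetric]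
      matrix_vector_right_distrib matrix_vector_mult_scaleR)

text \<open>The differential of \<open>ham\<close> comes from the product rule for the bilinear map
  \<open>A v *v x\<close>. Skewness of \<open>A r\<close> and \<open>inner_J\<close> then bring it
  into symplectic form.\<close>

lemma hamiltonian_field_ham:
  "hamiltonian_field ham ((x, z), (p, r)) =
    (let h = p - (1 / 2) *\<^sub>R (A r *v x)
     in ((h, - (1 / 2) *\<^sub>R J h x), (- (1 / 2) *\<^sub>R (A r *v h), 0)))"
proof (rule hamiltonian_field_eqI)
  interpret Ar: skew_matrix "A r" by (rule skew_A)
  define h where "h = p - (1 / 2) *\<^sub>R (A r *v x)"
  have "((\<lambda>l. fst (snd l) - (1 / 2) *\<^sub>R (A (snd (snd l)) *v fst (fst l))) has_derivative
      (\<lambda>l. fst (snd l) - (1 / 2) *\<^sub>R (A r *v fst (fst l) + A (snd (snd l)) *v x))) (at ((x, z), (p, r)))"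
    by (auto intro!: derivative_eq_intros bounded_bilinear.FDERIV[OF bounded_bilinear_A])
  from has_derivative_mult_right[OF has_derivative_inner[OF this this], of "1 / 2"]
  have "(ham has_derivative
      (\<lambda>l. h \<bullet> (fst (snd l) - (1 / 2) *\<^sub>R (A r *v fst (fst l) + A (snd (snd l)) *v x))))
      (at ((x, z), (p, r)))"
    by (simp add: ham_def[abs_def] Let_def h_def inner_commute)
  also have "(\<lambda>l. h \<bullet> (fst (snd l) - (1 / 2) *\<^sub>R (A r *v fst (fst l) + A (snd (snd l)) *v x))) =
    (\<lambda>l. symp_form l ((h, - (1 / 2) *\<^sub>R J h x), (- (1 / 2) *\<^sub>R (A r *v h), 0)))"
  proof -
    have "h \<bullet> (A r *v y) = - (y \<bullet> (A r *v h))" for y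
      using Ar.skew[of y h] by (simp add: inner_commute)
    then show ?thesis
      by (auto simp: fun_eq_iff symp_form_def inner_J inner_diff_right inner_add_right inner_commute
          diff_divide_distrib add_divide_distrib)
  qed
  finally show "(ham has_derivative (\<lambda>v. symp_form v (let h = p - (1 / 2) *\<^sub>R (A r *v x)
     in ((h, - (1 / 2) *\<^sub>R J h x), (- (1 / 2) *\<^sub>R (A r *v h), 0))))) (at ((x, z), (p, r)))"
    by (simp add: h_def Let_def)
qed

section \<open>The explicit extremals\<close>

abbreviation x_curve :: "real^'k \<Rightarrow> real^'m \<Rightarrow> real \<Rightarrow> real^'k" where
  "x_curve u v \<equiv> horizontal_curve (A v) u"

text \<open>For \<open>v = 0\<close> this is the zero curve, which is the correct vertical part in
  that case.\<close>

definition z_curve :: "real^'k \<Rightarrow> real^'m \<Rightarrow> real \<Rightarrow> real^'m" where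
  "z_curve u v t = ((t * (u \<bullet> u) - u \<bullet> x_curve u v t) / (2 * (norm v)\<^sup>2)) *\<^sub>R v"

text \<open>Both parts of the velocity contribute 0: \<open>u\<close> by the series argument, and
  \<open>A v *v x\<close> because the product of the anticommuting skew matrices \<open>A v\<close>
  and \<open>A w\<close> is again skew.\<close>

lemma inner_A_x_curve:
  assumes "w \<bullet> v = 0"
  shows "(u - A v *v x_curve u v t) \<bullet> (A w *v x_curve u v t) = 0"
proof -
  interpret Av: skew_matrix "A v" by (rule skew_A)
  interpret Aw: skew_matrix "A w" by (rule skew_A)
  let ?x = "x_curve u v t"
  have "u \<bullet> (A w *v ?x) = 0"
    by (rule anticommuting_inner_horizontal_curve[OF skew_A skew_A anticommute_A[OF assms]])
  moreover have "(A v *v ?x) \<bullet> (A w *v ?x) = 0"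
  proof -
    have "(A v *v ?x) \<bullet> (A w *v ?x) = - (?x \<bullet> (A v *v (A w *v ?x)))"
      by (rule Av.skew)
    also have "\<dots> = ?x \<bullet> (A w *v (A v *v ?x))"
      by (simp add: anticommute_A[OF assms])
    also have "\<dots> = - ((A v *v ?x) \<bullet> (A w *v ?x))"
      using Aw.skew[of ?x "A v *v ?x"] by (simp add: inner_commute)
    finally show ?thesis by simp
  qed
  ultimately show ?thesis
    by (simp add: inner_diff_left)
qed

text \<open>The velocity \<open>h\<close> solves \<open>h' = - A v *v h\<close> with a skew matrix,
  and it equals \<open>u\<close> at time 0.\<close>

lemma speed_constant:
  "(u - A v *v x_curve u v t) \<bullet> (u - A v *v x_curve u v t) = u \<bullet> u"
proof -
  interpret Av: skew_matrix "A v" by (rule skew_A)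
  let ?h = "\<lambda>t. u - A v *v x_curve u v t"
  have "(?h has_vector_derivative 0 - A v *v ?h t) (at t)" for t
    by (intro has_vector_derivative_diff has_vector_derivative_const
        has_vector_derivative_matrix_mult horizontal_curve_has_vector_derivative)
  from has_real_derivative_inner_self[OF this]
  have "((\<lambda>t. ?h t \<bullet> ?h t) has_vector_derivative 0) (at t)" for t
    by (simp add: has_real_derivative_iff_has_vector_derivative)
  from has_vector_derivative_zero_imp_const[OF this, of t] show ?thesis
    by simp
qed

text \<open>Both sides are tested against every \<open>w\<close>. The part of \<open>w\<close>
  orthogonal to \<open>v\<close> contributes nothing; along \<open>v\<close>, the equation
  \<open>A v *v x = u - h\<close> and the constancy of the speed give the coefficient.\<close>

lemma J_x_curve:
  "- (1 / 2) *\<^sub>R J (u - A v *v x_curve u v t) (x_curve u v t) =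
   ((u \<bullet> u - u \<bullet> (u - A v *v x_curve u v t)) / (2 * (norm v)\<^sup>2)) *\<^sub>R v"
    (is "?l = ?r")
proof -
  let ?x = "x_curve u v t"
  define h where "h = u - A v *v ?x"
  have "w \<bullet> ?l = w \<bullet> ?r" for w
  proof -
    \<comment> \<open>If \<open>v = 0\<close>, division by zero makes \<open>c = 0\<close>, and
      \<open>w - c *\<^sub>R v\<close> is still orthogonal to \<open>v\<close>.\<close>
    define c where "c = (w \<bullet> v) / (v \<bullet> v)"
    have "(w - c *\<^sub>R v) \<bullet> v = 0"
      by (simp add: c_def inner_diff_left)
    from inner_A_x_curve[OF this] have "h \<bullet> (A (w - c *\<^sub>R v) *v ?x) = 0"
      by (simp add: h_def)
    moreover have "A w *v ?x = A (w - c *\<^sub>R v) *v ?x + c *\<^sub>R (A v *v ?x)"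
      using A_add[of "w - c *\<^sub>R v" "c *\<^sub>R v"]
      by (simp add: A_scaleR matrix_vector_mult_add_rdistrib scaleR_matrix_vector_assoc)
    ultimately have "h \<bullet> (A w *v ?x) = c * (h \<bullet> (A v *v ?x))"
      by (simp add: inner_add_right)
    also have "A v *v ?x = u - h"
      by (simp add: h_def)
    finally have "h \<bullet> (A w *v ?x) = c * (u \<bullet> h - u \<bullet> u)"
      using speed_constant[of u v t] by (simp add: h_def[symmetric] inner_diff_right inner_commute)
    then have "w \<bullet> ?l = - (1 / 2) * (c * (u \<bullet> h - u \<bullet> u))"
      by (simp add: inner_J h_def)
    also have "\<dots> = w \<bullet> ?r"
      by (simp add: c_def h_def[symmetric] power2_norm_eq_inner divide_simps)
        (simp add: algebra_simps)
    finally show ?thesis .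
  qed
  then show ?thesis
    using vector_eq_ldot[of ?l ?r] by blast
qed

lemma z_curve_has_vector_derivative:
  "(z_curve u v has_vector_derivative
     - (1 / 2) *\<^sub>R J (u - A v *v x_curve u v t) (x_curve u v t)) (at t)"
proof -
  have "((\<lambda>t. u \<bullet> x_curve u v t) has_vector_derivative u \<bullet> (u - A v *v x_curve u v t)) (at t)"
    by (rule bounded_linear.has_vector_derivative[OF bounded_linear_inner_right horizontal_curve_has_vector_derivative])
  then have "((\<lambda>t. (t * (u \<bullet> u) - u \<bullet> x_curve u v t) / (2 * (norm v)\<^sup>2)) has_real_derivative
      (u \<bullet> u - u \<bullet> (u - A v *v x_curve u v t)) / (2 * (norm v)\<^sup>2)) (at t)"
    unfolding has_real_derivative_iff_has_vector_derivative[symmetric]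
    by (intro DERIV_cdivide DERIV_diff) (auto intro!: derivative_eq_intros)
  from has_vector_derivative_scaleR[OF this has_vector_derivative_const, of v]
  show ?thesis
    by (subst J_x_curve) (simp add: z_curve_def[abs_def])
qed

definition lift_curve ::
  "real^'k \<Rightarrow> real^'m \<Rightarrow> real \<Rightarrow> ((real^'k) \<times> (real^'m)) \<times> ((real^'k) \<times> (real^'m))" where
  "lift_curve u v t =
    ((x_curve u v t, z_curve u v t), (u - (1 / 2) *\<^sub>R (A v *v x_curve u v t), v))"

lemma integral_curve_lift_curve: "integral_curve (hamiltonian_field ham) (lift_curve u v)"
  unfolding integral_curve_def
proof
  fix t
  let ?x = "x_curve u v"
  let ?h = "u - A v *v ?x t"
  have "((\<lambda>t. u - (1 / 2) *\<^sub>R (A v *v ?x t)) has_vector_derivative 0 - (1 / 2) *\<^sub>R (A v *v ?h)) (at t)"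
    by (intro has_vector_derivative_diff has_vector_derivative_const has_vector_derivative_matrix_mult
        horizontal_curve_has_vector_derivative bounded_linear.has_vector_derivative[OF bounded_linear_scaleR_right])
  then have "(lift_curve u v has_vector_derivative
      ((?h, - (1 / 2) *\<^sub>R J ?h (?x t)), (- (1 / 2) *\<^sub>R (A v *v ?h), 0))) (at t)"
    unfolding lift_curve_def[abs_def]
    by (intro has_vector_derivative_Pair horizontal_curve_has_vector_derivative z_curve_has_vector_derivative
        has_vector_derivative_const) simp
  also have "((?h, - (1 / 2) *\<^sub>R J ?h (?x t)), (- (1 / 2) *\<^sub>R (A v *v ?h), 0)) =
      hamiltonian_field ham (lift_curve u v t)"
    by (simp only: lift_curve_def hamiltonian_field_ham half_plus_half Let_def)
  finally show "(lift_curve u v has_vector_derivative hamiltonian_field ham (lift_curve u v t)) (at t)" .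
qed

lemma lift_curve_0: "lift_curve u v 0 = (0, (u, v))"
  by (simp add: lift_curve_def z_curve_def zero_prod_def)

text \<open>The system is triangular and is solved in the order \<open>r\<close>, \<open>p\<close>,
  \<open>x\<close>, \<open>z\<close>. Each step compares with the explicit solution through a
  quantity of zero derivative; for \<open>x\<close> this is the squared distance, by skewness of
  \<open>A v\<close>.\<close>

lemma integral_curve_unique:
  assumes c: "integral_curve (hamiltonian_field ham) c" and c0: "c 0 = (0, (u, v))"
  shows "c = lift_curve u v"
proof
  fix t
  interpret Av: skew_matrix "A v" by (rule skew_A)
  define x z p r where "x t = fst (fst (c t))" and "z t = snd (fst (c t))"
    and "p t = fst (snd (c t))" and "r t = snd (snd (c t))" for t
  have c_eq: "c t = ((x t, z t), (p t, r t))" for t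
    by (simp add: x_def z_def p_def r_def)
  have init: "x 0 = 0" "z 0 = 0" "p 0 = u" "r 0 = v"
    by (simp_all add: x_def z_def p_def r_def c0)
  define h where "h t = p t - (1 / 2) *\<^sub>R (A (r t) *v x t)" for t
  have c': "(c has_vector_derivative
      ((h t, - (1 / 2) *\<^sub>R J (h t) (x t)), (- (1 / 2) *\<^sub>R (A (r t) *v h t), 0))) (at t)" for t
  proof -
    have "hamiltonian_field ham (c t) =
        ((h t, - (1 / 2) *\<^sub>R J (h t) (x t)), (- (1 / 2) *\<^sub>R (A (r t) *v h t), 0))"
      by (simp only: c_eq hamiltonian_field_ham h_def Let_def)
    then show ?thesis
      using c unfolding integral_curve_def by metis
  qed
  have x': "(x has_vector_derivative h t) (at t)" for t
    using has_vector_derivative_fst[OF has_vector_derivative_fst[OF c'[of t]]] by (simp add: x_def[abs_def])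
  have z': "(z has_vector_derivative - (1 / 2) *\<^sub>R J (h t) (x t)) (at t)" for t
    using has_vector_derivative_snd[OF has_vector_derivative_fst[OF c'[of t]]] by (simp add: z_def[abs_def])
  have p': "(p has_vector_derivative - (1 / 2) *\<^sub>R (A (r t) *v h t)) (at t)" for t
    using has_vector_derivative_fst[OF has_vector_derivative_snd[OF c'[of t]]] by (simp add: p_def[abs_def])
  have r': "(r has_vector_derivative 0) (at t)" for t
    using has_vector_derivative_snd[OF has_vector_derivative_snd[OF c'[of t]]] by (simp add: r_def[abs_def])
  have r: "r t = v" for t
    using has_vector_derivative_zero_imp_const[of r, OF r'] init by metis
  have p: "p t = u - (1 / 2) *\<^sub>R (A v *v x t)" for t
  proof -
    have "((\<lambda>t. p t + (1 / 2) *\<^sub>R (A v *v x t)) has_vector_derivative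
        - (1 / 2) *\<^sub>R (A (r t) *v h t) + (1 / 2) *\<^sub>R (A v *v h t)) (at t)" for t
      by (intro has_vector_derivative_add p' has_vector_derivative_matrix_mult x'
        bounded_linear.has_vector_derivative[OF bounded_linear_scaleR_right])
    then have "((\<lambda>t. p t + (1 / 2) *\<^sub>R (A v *v x t)) has_vector_derivative 0) (at t)" for t
      by (simp add: r)
    from has_vector_derivative_zero_imp_const[OF this, of t] show ?thesis
      by (simp add: init algebra_simps)
  qed
  have h: "h t = u - A v *v x t" for t
    unfolding h_def r p by (rule half_plus_half)
  have x: "x t = x_curve u v t" for t
  proof -
    define y where "y t = x t - x_curve u v t" for t
    have "(y has_vector_derivative h t - (u - A v *v x_curve u v t)) (at t)" for t
      unfolding y_def by (intro has_vector_derivative_diff x' horizontal_curve_has_vector_derivative)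
    then have "(y has_vector_derivative - (A v *v y t)) (at t)" for t
      by (simp add: h y_def matrix_vector_mult_diff_distrib)
    from has_real_derivative_inner_self[OF this]
    have "((\<lambda>t. y t \<bullet> y t) has_vector_derivative 0) (at t)" for t
      by (simp add: has_real_derivative_iff_has_vector_derivative)
    from has_vector_derivative_zero_imp_const[OF this, of t] show ?thesis
      by (simp add: y_def init)
  qed
  have z: "z t = z_curve u v t" for t
  proof -
    have "((\<lambda>t. z t - z_curve u v t) has_vector_derivative 0) (at t)" for t
      using has_vector_derivative_diff[OF z'[of t] z_curve_has_vector_derivative[of u v t]]
      by (simp add: h x)
    from has_vector_derivative_zero_imp_const[OF this, of t] show ?thesis
      by (simp add: init z_curve_def)
  qed
  show "c t = lift_curve u v t"
    by (simp add: c_eq lift_curve_def x z p r)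
qed

section \<open>Value at time 1 and homogeneity\<close>

lemma z_curve_1:
  assumes "v \<noteq> 0"
  shows "z_curve u v 1 =
    (((fun_mat g_fun (A v) *v u) \<bullet> u) / (2 * norm v)) *\<^sub>R ((1 / norm v) *\<^sub>R v)"
proof -
  interpret Av: skew_matrix "A v" by (rule skew_A)
  show ?thesis
    using assms by (simp add: z_curve_def Av.g_fun_inner power2_eq_square)
qed

lemma x_curve_scaleR: "x_curve (t *\<^sub>R u) (t *\<^sub>R v) 1 = x_curve u v t"
  by (simp add: horizontal_curve_def A_scaleR)

text \<open>In the coefficient, scaling gives a factor \<open>t\<close> above and
  \<open>t\<^sup>2\<close> below; the remaining \<open>t\<close> comes from the vector
  \<open>v\<close>. At \<open>t = 0\<close> both sides are 0.\<close>

lemma z_curve_scaleR: "z_curve (t *\<^sub>R u) (t *\<^sub>R v) 1 = z_curve u v t"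
proof (cases "t = 0")
  case False
  then show ?thesis
    by (cases "v = 0")
      (simp_all add: z_curve_def x_curve_scaleR power_mult_distrib divide_simps power2_eq_square
        algebra_simps)
qed (simp add: z_curve_def)

end

section \<open>Generalized H-type groups\<close>

locale carnot_coordinates =
  fixes G :: "('p, 'q) monoid_scheme"
    and E :: "'g::euclidean_space \<Rightarrow> 'p"
    and g1 g2 :: "'g set"
    and S :: "'g \<Rightarrow> 'g"
    and k n :: nat
    and e :: "'k::finite \<Rightarrow> 'g"
    and f :: "'m::finite \<Rightarrow> 'g"
  assumes carnot: "step2_carnot_group G E g1 g2 k n"
    and H_type: "H_type_operator G E g1 g2 S"
    and basis_e: "orthonormal_basis_of g1 e"
    and basis_f: "orthonormal_basis_of g2 f"
begin

section \<open>The group law in the exponential chart and the step 2 condition\<close>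

lemma exp_chart: "exp_chart (\<lambda>(X, Y). inv_into UNIV E (E X \<otimes>\<^bsub>G\<^esub> E Y))"
proof -
  have lie: "lie_group_exp G E"
    using carnot by (simp add: step2_carnot_group_def)
  then interpret group G
    by (simp add: lie_group_exp_def)
  have bij: "bij_betw E UNIV (carrier G)"
    using lie by (simp add: lie_group_exp_def)
  have log: "inv_into UNIV E (E X) = X" for X
    by (rule bij_betw_inv_into_left[OF bij]) simp
  have exp: "E (inv_into UNIV E g) = g" if "g \<in> carrier G" for g
    by (rule bij_betw_inv_into_right[OF bij that])
  have carr: "E X \<in> carrier G" for X
    using bij by (auto simp: bij_betw_def)
  show ?thesis
  proof
    show "smooth (\<lambda>(X, Y). inv_into UNIV E (E X \<otimes>\<^bsub>G\<^esub> E Y))"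
      using lie by (simp add: lie_group_exp_def)
  next
    fix x s t
    have "E ((s + t) *\<^sub>R x) = E (s *\<^sub>R x) \<otimes>\<^bsub>G\<^esub> E (t *\<^sub>R x)"
      using lie by (simp add: lie_group_exp_def)
    then show "(case (s *\<^sub>R x, t *\<^sub>R x) of (X, Y) \<Rightarrow> inv_into UNIV E (E X \<otimes>\<^bsub>G\<^esub> E Y)) = (s + t) *\<^sub>R x"
      by (metis case_prod_conv log)
  qed (simp add: exp carr m_assoc)
qed

sublocale chart: exp_chart "\<lambda>(X, Y). inv_into UNIV E (E X \<otimes>\<^bsub>G\<^esub> E Y)"
  by (rule exp_chart)

lemma left_field_eq: "left_field G E = chart.left"
  by (simp add: fun_eq_iff left_field_def chart.left_eq)

lemma lie_bracket_eq: "lie_bracket G E = chart.bracket"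
  by (simp add: fun_eq_iff lie_bracket_def chart.bracket_def left_field_eq)

lemma e_in_g1 [simp]: "e i \<in> g1" and f_in_g2 [simp]: "f \<alpha> \<in> g2"
  using basis_e basis_f by (auto simp: orthonormal_basis_of_def intro: span_base)

lemma inner_e: "inner (e i) (e j) = (if i = j then 1 else 0)"
  and inner_f: "inner (f \<alpha>) (f \<beta>) = (if \<alpha> = \<beta> then 1 else 0)"
  using basis_e basis_f by (auto simp: orthonormal_basis_of_def)

lemma inner_g1_g2: "X \<in> g1 \<Longrightarrow> Z \<in> g2 \<Longrightarrow> inner X Z = 0"
  using carnot by (auto simp: step2_carnot_group_def orthogonal_def)

lemma decompose: obtains Y Z where "Y \<in> g1" "Z \<in> g2" "X = Y + Z"
  using carnot unfolding step2_carnot_group_def by metis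

lemma bracket_g2 [simp]:
  assumes "Z \<in> g2"
  shows "chart.bracket X Z = 0" "chart.bracket Z X = 0"
proof -
  obtain Y W where "Y \<in> g1" "W \<in> g2" "X = Y + W"
    by (rule decompose)
  then show "chart.bracket X Z = 0"
    using carnot assms
    by (simp add: step2_carnot_group_def lie_bracket_eq linear_add[OF chart.linear_bracket_left])
  then show "chart.bracket Z X = 0"
    using chart.bracket_antisym[of Z X] by simp
qed

lemma bracket_in_g2 [simp]: "chart.bracket X Y \<in> g2"
proof -
  obtain X1 X2 Y1 Y2 where "X1 \<in> g1" "X2 \<in> g2" "X = X1 + X2" "Y1 \<in> g1" "Y2 \<in> g2" "Y = Y1 + Y2"
    using decompose by metis
  moreover have "chart.bracket X1 Y1 \<in> g2" if "X1 \<in> g1" "Y1 \<in> g1"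
  proof -
    have "span {lie_bracket G E X Y | X Y. X \<in> g1 \<and> Y \<in> g1} = g2"
      using carnot by (simp add: step2_carnot_group_def)
    with that show ?thesis
      by (auto simp: lie_bracket_eq intro: span_base)
  qed
  ultimately show ?thesis
    by (simp add: linear_add[OF chart.linear_bracket_left] linear_add[OF chart.linear_bracket_right])
qed

text \<open>The inner of two nested brackets lies in \<open>g2\<close>, which every bracket
  annihilates, so the nilpotency hypothesis of \<open>left_eq_half_bracket\<close> holds.\<close>

lemma left_eq: "chart.left Y X = Y + (1 / 2) *\<^sub>R chart.bracket X Y"
  by (rule chart.left_eq_half_bracket) simp

lemma L_mat_nth: "L_mat G E e f \<alpha> $ i $ j = inner (chart.bracket (e i) (e j)) (f \<alpha>)"
  by (simp add: L_mat_def lie_bracket_eq)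

lemma L_mat_skew: "L_mat G E e f \<alpha> $ i $ j = - L_mat G E e f \<alpha> $ j $ i"
  using chart.bracket_antisym[of "e i" "e j"] by (simp add: L_mat_nth)

text \<open>The field is the half bracket formula at the point \<open>(x, z)\<close>: the part of
  the point in \<open>g2\<close> is central, and the minus sign comes from exchanging the indices of
  the skew structure constants.\<close>

lemma frame_field_eq:
  "frame_field G E e f i (x, z) = (axis i 1, (\<chi> \<alpha>. - (1 / 2) * (L_mat G E e f \<alpha> *v x) $ i))"
proof -
  have "chart.bracket (\<Sum>\<alpha>\<in>UNIV. z $ \<alpha> *\<^sub>R f \<alpha>) (e i) = 0"
    by (simp add: linear_sum[OF chart.linear_bracket_left] linear_cmul[OF chart.linear_bracket_left])
  then have bracket: "chart.bracket (lincomb e f (x, z)) (e i) =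
      (\<Sum>j\<in>UNIV. x $ j *\<^sub>R chart.bracket (e j) (e i))"
    by (simp add: lincomb_def linear_add[OF chart.linear_bracket_left]
        linear_sum[OF chart.linear_bracket_left] linear_cmul[OF chart.linear_bracket_left])
  have "inner (chart.bracket (lincomb e f (x, z)) (e i)) (e j) = 0" for j
    using inner_g1_g2[OF e_in_g1 bracket_in_g2] by (simp add: inner_commute)
  moreover have "inner (chart.bracket (lincomb e f (x, z)) (e i)) (f \<alpha>) =
      - ((L_mat G E e f \<alpha> *v x) $ i)" for \<alpha>
  proof -
    have "inner (chart.bracket (lincomb e f (x, z)) (e i)) (f \<alpha>) =
        (\<Sum>j\<in>UNIV. x $ j * L_mat G E e f \<alpha> $ j $ i)"
      by (simp add: bracket inner_sum_left L_mat_nth)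
    also have "\<dots> = - ((L_mat G E e f \<alpha> *v x) $ i)"
      by (simp add: matrix_vector_mult_def L_mat_skew[of _ _ i] sum_negf mult.commute)
    finally show ?thesis .
  qed
  ultimately show ?thesis
    by (simp add: frame_field_def left_field_eq left_eq inner_add_left inner_e inner_g1_g2
        axis_def vec_eq_iff)
qed

text \<open>In the chosen bases, \<open>J_V\<close> is the matrix \<open>L_v\<close>, since its
  entry at \<open>(i, j)\<close> is the inner product of \<open>V\<close> with the bracket of
  \<open>e i\<close> and \<open>e j\<close>.\<close>

lemma J_op_eq:
  "J_op G E g1 (\<Sum>\<alpha>\<in>UNIV. v $ \<alpha> *\<^sub>R f \<alpha>) (\<Sum>j\<in>UNIV. y $ j *\<^sub>R e j) =
    (\<Sum>i\<in>UNIV. (L_of G E e f v *v y) $ i *\<^sub>R e i)"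
proof -
  let ?V = "\<Sum>\<alpha>\<in>UNIV. v $ \<alpha> *\<^sub>R f \<alpha>"
  let ?Y = "\<Sum>j\<in>UNIV. y $ j *\<^sub>R e j"
  let ?Z = "\<Sum>i\<in>UNIV. (L_of G E e f v *v y) $ i *\<^sub>R e i"
  have g1: "g1 = span (range e)"
    using basis_e by (simp add: orthonormal_basis_of_def)
  have Z: "?Z \<in> g1"
    unfolding g1 by (intro span_sum span_scale span_base) simp
  have e: "inner (e i) ?Z = inner ?V (chart.bracket (e i) ?Y)" for i
  proof -
    have "inner ?V (chart.bracket (e i) ?Y) =
        (\<Sum>j\<in>UNIV. y $ j * (\<Sum>\<alpha>\<in>UNIV. v $ \<alpha> * L_mat G E e f \<alpha> $ i $ j))"
      by (simp add: linear_sum[OF chart.linear_bracket_right] linear_cmul[OF chart.linear_bracket_right]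
          inner_sum_left inner_sum_right L_mat_nth inner_commute)
    also have "\<dots> = (L_of G E e f v *v y) $ i"
      by (simp add: L_of_def matrix_vector_mult_def mult.commute)
    also have "\<dots> = inner (e i) ?Z"
      by (simp add: inner_sum_right inner_e mult_delta_right)
    finally show ?thesis by simp
  qed
  have all: "inner X ?Z = inner ?V (chart.bracket X ?Y)" if "X \<in> g1" for X
    using that unfolding g1
  proof (induction rule: span_induct_alt)
    case base
    then show ?case by (simp add: linear_0[OF chart.linear_bracket_left])
  next
    case (step c x y)
    then show ?case
      by (auto simp: inner_add_left inner_add_right e linear_add[OF chart.linear_bracket_left]
          linear_cmul[OF chart.linear_bracket_left])
  qed
  show ?thesis
    unfolding J_op_def lie_bracket_eq
  proof (rule the_equality)
    \<comment> \<open>Two candidates differ by an element of \<open>g1\<close> that is orthogonal to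
      all of \<open>g1\<close>, in particular to itself.\<close>
    fix W assume W: "W \<in> g1 \<and> (\<forall>X\<in>g1. inner X W = inner ?V (chart.bracket X ?Y))"
    then have "W - ?Z \<in> g1"
      using Z unfolding g1 by (intro span_diff) auto
    with W all have "inner (W - ?Z) (W - ?Z) = 0"
      by (simp add: inner_diff_right)
    then show "W = ?Z" by simp
  qed (use Z all in blast)
qed

text \<open>Orthonormal bases preserve the inner product of \<open>v\<close> and \<open>w\<close>,
  so the H-type relation for the corresponding elements of \<open>g2\<close> has right-hand side 0;
  \<open>J_op_eq\<close> carries it over to the matrices.\<close>

lemma L_of_anticommute:
  assumes "inner v w = 0"
  shows "L_of G E e f v *v (L_of G E e f w *v y) = - (L_of G E e f w *v (L_of G E e f v *v y))"
proof -
  let ?F = "\<lambda>v. \<Sum>\<alpha>\<in>UNIV. v $ \<alpha> *\<^sub>R f \<alpha>"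
  let ?E = "\<lambda>y. \<Sum>j\<in>UNIV. y $ j *\<^sub>R e j"
  have F: "?F v \<in> g2" for v
    using basis_f unfolding orthonormal_basis_of_def
    by (metis (no_types, lifting) rangeI span_base span_scale span_sum)
  have Y: "?E y \<in> g1"
    using basis_e unfolding orthonormal_basis_of_def
    by (metis (no_types, lifting) rangeI span_base span_scale span_sum)
  have "inner (?F v) (?F w) = inner v w"
  proof -
    have "inner (?F v) (f \<alpha>) = v $ \<alpha>" for \<alpha>
      by (simp add: inner_sum_left inner_f mult_delta_right)
    then have "inner (?F v) (?F w) = (\<Sum>\<alpha>\<in>UNIV. w $ \<alpha> * v $ \<alpha>)"
      by (subst inner_sum_right) simp
    then show ?thesis
      by (simp add: inner_vec_def mult.commute)
  qed
  with assms have "J_op G E g1 (?F v) (J_op G E g1 (?F w) (?E y)) +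
      J_op G E g1 (?F w) (J_op G E g1 (?F v) (?E y)) = 0"
    using H_type F Y by (simp add: H_type_operator_def)
  then have "?E (L_of G E e f v *v (L_of G E e f w *v y) + L_of G E e f w *v (L_of G E e f v *v y)) = 0"
    by (simp add: J_op_eq scaleR_left_distrib sum.distrib)
  moreover have "inner (?E y) (e i) = y $ i" for y i
    by (simp add: inner_sum_left inner_e mult_delta_right)
  ultimately have "(L_of G E e f v *v (L_of G E e f w *v y) + L_of G E e f w *v (L_of G E e f v *v y)) $ i = 0" for i
    by (metis inner_zero_left)
  then have "L_of G E e f v *v (L_of G E e f w *v y) + L_of G E e f w *v (L_of G E e f v *v y) = 0"
    by (simp only: vec_eq_iff zero_index simp_thms)
  then show ?thesis
    by (simp add: eq_neg_iff_add_eq_0)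
qed

section \<open>Extremals and exponential map of the group\<close>

sublocale mats: h_type_matrices "L_mat G E e f"
  using L_of_anticommute by unfold_locales (auto simp: L_of_def intro: L_mat_skew)

lemma A_eq: "mats.A = L_of G E e f"
  by (simp add: fun_eq_iff mats.A_def L_of_def)

lemma sr_hamiltonian_eq: "sr_hamiltonian G E e f = mats.ham"
proof
  fix l :: "((real^'k) \<times> (real^'m)) \<times> ((real^'k) \<times> (real^'m))"
  obtain x z p r where l: "l = ((x, z), (p, r))"
    by (metis surj_pair)
  have "inner (p, r) (frame_field G E e f i (x, z)) = (p - (1 / 2) *\<^sub>R (mats.A r *v x)) $ i" for i
    by (simp add: frame_field_eq inner_axis mats.A_mult_vec inner_vec_def[of r] sum_distrib_left
        sum_negf sum_divide_distrib mult_ac)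
  then show "sr_hamiltonian G E e f l = mats.ham l"
    by (simp add: sr_hamiltonian_def mats.ham_def l Let_def inner_vec_def power2_eq_square)
qed

lemma extremal_eq: "extremal G E e f (u, v) = mats.lift_curve u v"
  unfolding extremal_def sr_hamiltonian_eq
  by (rule the_equality)
    (auto simp: mats.integral_curve_lift_curve mats.lift_curve_0 dest: mats.integral_curve_unique)

lemma sr_geodesic_eq:
  "sr_geodesic G E e f (u, v) t = exp_point E e f (mats.x_curve u v t, mats.z_curve u v t)"
  by (simp add: sr_geodesic_def extremal_eq mats.lift_curve_def)

lemma sr_exp_eq:
  "sr_exp G E e f (u, v) = exp_point E e f (mats.x_curve u v 1, mats.z_curve u v 1)"
  by (simp add: sr_exp_def extremal_eq mats.lift_curve_def)

lemma sr_exp_nonzero_vertical: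
  assumes "v \<noteq> 0"
  shows "sr_exp G E e f (u, v) =
    exp_point E e f
      (fun_mat f_fun (L_of G E e f v) *v u,
       (inner (fun_mat g_fun (L_of G E e f v) *v u) u / (2 * norm v)) *\<^sub>R ((1 / norm v) *\<^sub>R v))"
  unfolding sr_exp_eq mats.z_curve_1[OF assms] by (simp add: horizontal_curve_def A_eq)

lemma sr_exp_zero_vertical: "sr_exp G E e f (u, 0) = exp_point E e f (u, 0)"
proof -
  \<comment> \<open>Positive powers of the zero matrix vanish, so only the initial term
    \<open>u\<close> of the series remains.\<close>
  have "(\<lambda>r. ((- 1) ^ r / fact (Suc r) * 1 ^ Suc r) *\<^sub>R (((*v) (0 :: real^'k^'k)) ^^ r) u) =
      (\<lambda>r. if r = 0 then u else 0)"
  proof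
    show "((- 1) ^ r / fact (Suc r) * 1 ^ Suc r) *\<^sub>R (((*v) (0 :: real^'k^'k)) ^^ r) u =
        (if r = 0 then u else 0)" for r
      by (cases r) simp_all
  qed
  then have "horizontal_curve 0 u 1 = u"
    using sums_unique2[OF horizontal_curve_sums[of 1 0 u]] sums_single[of 0 "\<lambda>_. u"] by simp
  then show ?thesis
    by (simp add: sr_exp_eq mats.z_curve_def mats.A_def)
qed

lemma sr_geodesic_eq_sr_exp:
  "sr_geodesic G E e f (u, v) t = sr_exp G E e f (t *\<^sub>R u, t *\<^sub>R v)"
  by (simp add: sr_geodesic_eq sr_exp_eq mats.x_curve_scaleR mats.z_curve_scaleR)

end

theorem lemma16:
  fixes G :: "('p, 'q) monoid_scheme"
    and E :: "'g::euclidean_space \<Rightarrow> 'p"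
    and g1 g2 :: "'g set"
    and S :: "'g \<Rightarrow> 'g"
    and k n :: nat
    and e :: "'k::finite \<Rightarrow> 'g"
    and f :: "'m::finite \<Rightarrow> 'g"
  assumes "step2_carnot_group G E g1 g2 k n"
    and "H_type_operator G E g1 g2 S"
    and "CARD('k) = k" and "CARD('m) = n - k"
    and "orthonormal_basis_of g1 e" and "diagonalizes e S"
    and "orthonormal_basis_of g2 f"
  shows "(\<forall>(u::real^'k) (v::real^'m). v \<noteq> 0 \<longrightarrow>
            sr_exp G E e f (u, v) =
              exp_point E e f
                (fun_mat f_fun (L_of G E e f v) *v u,
                 (inner (fun_mat g_fun (L_of G E e f v) *v u) u / (2 * norm v))
                    *\<^sub>R ((1 / norm v) *\<^sub>R v))) \<and>
         (\<forall>u::real^'k. sr_exp G E e f (u, 0) = exp_point E e f (u, 0)) \<and>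
         (\<forall>(u::real^'k) (v::real^'m). \<forall>t\<in>{0..1}.
            sr_geodesic G E e f (u, v) t = sr_exp G E e f (t *\<^sub>R u, t *\<^sub>R v))"
proof -
  interpret carnot_coordinates G E g1 g2 S k n e f
    by unfold_locales (use assms in auto)
  show ?thesis
    using sr_exp_nonzero_vertical sr_exp_zero_vertical sr_geodesic_eq_sr_exp by blast
qed

end
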